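(* Let $\mathbf{x} = (\mathbf{x}_1,\mathbf{x}_2,\mathbf{x}_3,\mathbf{x}_4) \in C_4(H^2)$ be a configuration of four distinct points of the hyperbolic plane $H^2$ such that no point of the configuration lies in the (hyperbolic) convex hull of the other three. Then the normalized Atiyah-Sutcliffe determinant $D$ satisfies \[ |D(\mathbf{x})| \geq 1 . \]
   Context: Hyperbolic $3$-space $H^3$ is the open unit ball in $\mathbb{R}^3$ centered at the origin (Poincaré ball model), with boundary sphere at infinity $S^2_{\infty}$ (the unit sphere). $H^2$ is regarded as the totally geodesic plane in $H^3$ given by $y=0$. $C_n(H^3)$ (resp. $C_n(H^2)$) is the configuration space of ordered $n$-tuples $\mathbf{x}=(\mathbf{x}_1,\ldots,\mathbf{x}_n)$ of distinct points of $H^3$ (resp. $H^2$). $S^2_{\infty}$ is identified with the Riemann sphere $\hat{\mathbb{C}}=\mathbb{C}\cup\{\infty\}$ via stereographic projection: $s(x,y,z)=\frac{x+iy}{1-z}$ if $(x,y,z)\neq(0,0,1)$, and $s(0,0,1)=\infty$. (Thus points of the boundary circle of $H^2$ correspond to elements of $\mathbb{R}\cup\{\infty\}$.) For $1\le a,b\le n$ with $a\neq b$, $t_{ab}\in\hat{\mathbb{C}}$ denotes the limiting point on $S^2_{\infty}$ of the hyperbolic ray starting at $\mathbf{x}_a$ and passing through $\mathbf{x}_b$. Put $p_{ab}(t)=t-t_{ab}$ if $t_{ab}\neq\infty$, and $p_{ab}(t)=1$ if $t_{ab}=\infty$. For $1\le a\le n$ let \[ p_a(t)=\prod_{b\neq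 a} p_{ab}(t), \] a complex polynomial in $t$ of degree at most $n-1$. The normalized Atiyah-Sutcliffe determinant is \[ D(\mathbf{x})=\frac{\det(p_1,\ldots,p_n)}{\prod_{1\le a<b\le n}\det(p_{ab},p_{ba})} . \] In the numerator, each $p_a$ is identified with its $n$-dimensional vector of coefficients in increasing powers $1,t,\ldots,t^{n-1}$, and $\det(p_1,\ldots,p_n)$ is the determinant of the $n\times n$ matrix whose $b$-th column is $p_b$. In the denominator, each $p_{ab}$ is likewise identified with its $2$-dimensional vector of coefficients (of $1,t$), and $\det(p_{ab},p_{ba})$ is the corresponding $2\times 2$ determinant. (Replacing any $p_{ab}$ by a nonzero scalar multiple, and $p_a$ accordingly, does not change $D(\mathbf{x})$.) *)

theory Defs
  imports "HOL-Analysis.Analysis" "Jordan_Normal_Form.Determinant"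
begin

no_notation Matrix.vec_index (infixl "$" 100)

definition H3 :: "(real ^ 3) set" where
  "H3 = ball 0 1"

definition H2 :: "(real ^ 3) set" where
  "H2 = {v \<in> H3. v $ 2 = 0}"

definition hdist :: "real ^ 3 \<Rightarrow> real ^ 3 \<Rightarrow> real" where
  "hdist u v = arcosh (1 + 2 * (norm (u - v))\<^sup>2 / ((1 - (norm u)\<^sup>2) * (1 - (norm v)\<^sup>2)))"

definition geodesic_on :: "real set \<Rightarrow> (real \<Rightarrow> real ^ 3) \<Rightarrow> bool" where
  "geodesic_on I \<gamma> \<longleftrightarrow>
     \<gamma> ` I \<subseteq> H3 \<and> (\<forall>s\<in>I. \<forall>t\<in>I. hdist (\<gamma> s) (\<gamma> t) = \<bar>s - t\<bar>)"

text \<open>The limiting point on the sphere at infinity of the ray from \<open>u\<close> through \<open>v\<close>. The limit is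
  taken in the ambient Euclidean space. For distinct points of \<open>H3\<close> the ray, and hence the limit,
  exists and is unique.\<close>

definition ray_end :: "real ^ 3 \<Rightarrow> real ^ 3 \<Rightarrow> real ^ 3" where
  "ray_end u v = (THE \<xi>. \<exists>\<gamma>. geodesic_on {0..} \<gamma> \<and> \<gamma> 0 = u \<and> v \<in> \<gamma> ` {0..} \<and>
                            (\<gamma> \<longlongrightarrow> \<xi>) at_top)"

definition hyp_convex :: "(real ^ 3) set \<Rightarrow> bool" where
  "hyp_convex C \<longleftrightarrow> C \<subseteq> H3 \<and>
     (\<forall>\<gamma> L. geodesic_on {0..L} \<gamma> \<and> \<gamma> 0 \<in> C \<and> \<gamma> L \<in> C \<longrightarrow> \<gamma> ` {0..L} \<subseteq> C)"

text \<open>The hyperbolic convex hull of \<open>S\<close> is \<open>hyp_convex hull S\<close>. As \<open>H2\<close> is totally geodesic, the hull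
  of a subset of \<open>H2\<close> is the same whether formed in \<open>H2\<close> or in \<open>H3\<close>.\<close>

text \<open>Configurations are indexed by \<open>{1..n}\<close>; values outside this range are irrelevant.\<close>

definition configs :: "nat \<Rightarrow> (real ^ 3) set \<Rightarrow> (nat \<Rightarrow> real ^ 3) set" where
  "configs n X = {x. x \<in> {1..n} \<rightarrow> X \<and> inj_on x {1..n}}"

text \<open>The Riemann sphere is \<open>complex option\<close>, with \<open>None\<close> as the point at infinity.\<close>

definition stereo :: "real ^ 3 \<Rightarrow> complex option" where
  "stereo v = (if v = vector [0, 0, 1] then None
               else Some (Complex (v $ 1) (v $ 2) / of_real (1 - v $ 3)))"

definition t_end :: "(nat \<Rightarrow> real ^ 3) \<Rightarrow> nat \<Rightarrow> nat \<Rightarrow> complex option" where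
  "t_end x a b = stereo (ray_end (x a) (x b))"

definition p_pair :: "(nat \<Rightarrow> real ^ 3) \<Rightarrow> nat \<Rightarrow> nat \<Rightarrow> complex poly" where
  "p_pair x a b = (case t_end x a b of None \<Rightarrow> 1 | Some \<tau> \<Rightarrow> [:- \<tau>, 1:])"

definition p_point :: "nat \<Rightarrow> (nat \<Rightarrow> real ^ 3) \<Rightarrow> nat \<Rightarrow> complex poly" where
  "p_point n x a = (\<Prod>b\<in>{1..n} - {a}. p_pair x a b)"

definition poly_det :: "complex poly list \<Rightarrow> complex" where
  "poly_det ps =
     Determinant.det (Matrix.mat (length ps) (length ps) (\<lambda>(i, j). coeff (ps ! j) i))"

definition AS_det :: "nat \<Rightarrow> (nat \<Rightarrow> real ^ 3) \<Rightarrow> complex" where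
  "AS_det n x =
     poly_det (map (p_point n x) [1..<Suc n]) /
     (\<Prod>(a, b)\<in>{(a, b). 1 \<le> a \<and> a < b \<and> b \<le> n}. poly_det [p_pair x a b, p_pair x b a])"

end

theory Submission
  imports Defs
begin

text \<open>  Write the boundary point \<open>t\<^sub>a\<^sub>b\<close> in homogeneous coordinates as a vector \<open>w\<^sub>a\<^sub>b\<close> of the real plane, and let
  \<open>[u, v]\<close> be the determinant of two such vectors. The denominator of \<open>D\<close> is, up to sign, the product
  of the six brackets \<open>[w\<^sub>a\<^sub>b, w\<^sub>b\<^sub>a]\<close>, and the numerator is a polynomial in the brackets.

  Four points in convex position are the vertices of a convex quadrilateral. Label them so that the
  diagonals are \<open>13\<close> and \<open>24\<close> and the orientation is positive. Running once around the boundary circle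
  one meets, in this order,

    \<open>t\<^sub>3\<^sub>1,  {t\<^sub>4\<^sub>1, t\<^sub>3\<^sub>2},  t\<^sub>4\<^sub>2,  {t\<^sub>1\<^sub>2, t\<^sub>4\<^sub>3},  t\<^sub>1\<^sub>3,  {t\<^sub>2\<^sub>3, t\<^sub>1\<^sub>4},  t\<^sub>2\<^sub>4,  {t\<^sub>3\<^sub>4, t\<^sub>2\<^sub>1}\<close>.

  The ends of the diagonals cut the circle into four arcs. The order of the two points inside an arc
  depends on whether two opposite sides meet beyond it, and is left open. After a choice of signs of
  the \<open>w\<^sub>a\<^sub>b\<close>, the bracket \<open>[u, v]\<close> is positive whenever \<open>u\<close> comes strictly before \<open>v\<close> in this list.
  The heart of the proof is the identity \<open>poly_det_cubics\<close>: the numerator is, up to sign, the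
  denominator plus ten products of six brackets, and no bracket in it pairs two points of the same arc.
  So every term is positive, and \<open>|D| \<ge> 1\<close>. Only the cyclic order of the twelve points enters.

  The cyclic order is obtained in the hyperboloid model. There the ray from \<open>U\<close> through \<open>V\<close> ends at
  the null vector \<open>V - e\<^sup>-\<^sup>d U\<close>, where \<open>d\<close> is the distance of \<open>U\<close> and \<open>V\<close> (\<open>ray_end_eq\<close>). Points of the
  plane become positive definite binary quadratic forms and null vectors become squares of linear
  forms (\<open>ray_spinor\<close>), here a positive multiple of the square given by \<open>w\<^sub>a\<^sub>b\<close>. Convex position means
  that the only linear relation between the four points has two coefficients of either sign
  (\<open>dependency_signs\<close>). Moving the negative ones to the other side expresses the point \<open>Z\<close> in which the
  diagonals cross in two ways, and comparing forms with \<open>Z\<close> places every \<open>w\<^sub>a\<^sub>b\<close> between the ends of the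
  diagonals (\<open>between_by_nullity\<close>, \<open>quadrilateral_sectors\<close>).\<close>

no_notation scalar_prod (infix "\<bullet>" 70)

section \<open>The hyperboloid model\<close>

type_synonym spacetime = "real \<times> (real ^ 3)"

text \<open>The Lorentzian scalar product with signature \<open>(+,-,-,-)\<close>. With this sign the product of two points of
  the hyperboloid is the hyperbolic cosine of their distance.\<close>

definition mink :: "spacetime \<Rightarrow> spacetime \<Rightarrow> real" where
  "mink X Y = fst X * fst Y - snd X \<bullet> snd Y"

lemma mink_linear:
  "mink (X + Y) Z = mink X Z + mink Y Z" "mink Z (X + Y) = mink Z X + mink Z Y"
  "mink (X - Y) Z = mink X Z - mink Y Z" "mink Z (X - Y) = mink Z X - mink Z Y"
  "mink (c *\<^sub>R X) Z = c * mink X Z" "mink Z (c *\<^sub>R X) = c * mink Z X"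
  by (simp_all add: mink_def algebra_simps inner_simps)

lemma mink_commute: "mink X Y = mink Y X"
  by (simp add: mink_def inner_commute mult.commute)

definition hyperboloid :: "spacetime set" where
  "hyperboloid = {X. mink X X = 1 \<and> fst X > 0}"

text \<open>The central projection that identifies the ball with the upper sheet of the hyperboloid; its inverse
  is \<open>to_ball\<close>.\<close>

definition lift :: "real ^ 3 \<Rightarrow> spacetime" where
  "lift u = ((1 + (norm u)\<^sup>2) / (1 - (norm u)\<^sup>2), (2 / (1 - (norm u)\<^sup>2)) *\<^sub>R u)"

definition to_ball :: "spacetime \<Rightarrow> real ^ 3" where
  "to_ball X = (1 / (1 + fst X)) *\<^sub>R snd X"

lemma H3_norm: "u \<in> H3 \<longleftrightarrow> (norm u)\<^sup>2 < 1"
  by (simp add: H3_def power2_eq_square abs_square_less_1 flip: power2_eq_square)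

lemma lift_in_hyperboloid:
  assumes "u \<in> H3" shows "lift u \<in> hyperboloid"
proof -
  define n where "n = (norm u)\<^sup>2"
  have n: "0 \<le> n" "n < 1" using assms by (simp_all add: n_def H3_norm)
  have "mink (lift u) (lift u) = ((1 + n) / (1 - n))\<^sup>2 - (2 / (1 - n))\<^sup>2 * n"
    by (simp add: mink_def lift_def dot_square_norm n_def power2_eq_square)
  also have "\<dots> = 1" using n by (simp add: divide_simps power2_eq_square) Groebner_Basis.algebra
  finally show ?thesis using n by (simp add: hyperboloid_def lift_def flip: n_def)
qed

lemma to_ball_lift:
  assumes "u \<in> H3" shows "to_ball (lift u) = u"
proof -
  have "1 - (norm u)\<^sup>2 > 0" using assms by (simp add: H3_norm)
  moreover from this have "1 + fst (lift u) = 2 / (1 - (norm u)\<^sup>2)"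
    by (simp add: lift_def add_divide_eq_iff)
  ultimately have "to_ball (lift u) = (inverse (2 / (1 - (norm u)\<^sup>2)) * (2 / (1 - (norm u)\<^sup>2))) *\<^sub>R u"
    by (simp only: to_ball_def inverse_eq_divide) (simp only: lift_def snd_conv scaleR_scaleR)
  with \<open>1 - (norm u)\<^sup>2 > 0\<close> show ?thesis by (subst (asm) left_inverse) auto
qed

lemma to_ball_hyperboloid:
  assumes "X \<in> hyperboloid" shows "to_ball X \<in> H3" "lift (to_ball X) = X"
proof -
  obtain t s where X: "X = (t, s)" by (cases X)
  have t: "t > 0" and s: "s \<bullet> s = t\<^sup>2 - 1"
    using assms by (auto simp: X hyperboloid_def mink_def power2_eq_square)
  have n: "(norm (to_ball X))\<^sup>2 = (t - 1) / (t + 1)"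
  proof -
    have "(norm (to_ball X))\<^sup>2 = (t\<^sup>2 - 1) / (1 + t)\<^sup>2"
      using s by (simp add: X to_ball_def power_mult_distrib power_divide dot_square_norm)
    also have "\<dots> = (t - 1) / (t + 1)" using t by (simp add: divide_simps) Groebner_Basis.algebra
    finally show ?thesis .
  qed
  show "to_ball X \<in> H3" using t by (simp add: H3_norm n divide_simps)
  have "1 - (norm (to_ball X))\<^sup>2 = 2 / (t + 1)" "1 + (norm (to_ball X))\<^sup>2 = 2 * t / (t + 1)"
    using t by (simp_all add: n field_simps)
  then show "lift (to_ball X) = X" using t by (simp add: lift_def X to_ball_def add.commute)
qed

text \<open>A causal vector that has positive product with a future point lies in the future cone: by the
  Cauchy-Schwarz inequality the time components decide the sign of the product.\<close>

lemma future_directed: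
  assumes "U \<in> hyperboloid" "mink X X \<ge> 0" "mink X U > 0"
  shows "fst X > 0"
proof (rule ccontr)
  assume "\<not> fst X > 0"
  then have X0: "fst X \<le> 0" by simp
  have U: "fst U > 0" "snd U \<bullet> snd U = (fst U)\<^sup>2 - 1"
    using assms(1) by (auto simp: hyperboloid_def mink_def power2_eq_square)
  have "(snd X \<bullet> snd U)\<^sup>2 \<le> (snd X \<bullet> snd X) * (snd U \<bullet> snd U)"
    by (rule Cauchy_Schwarz_ineq)
  also have "\<dots> \<le> (fst X)\<^sup>2 * (fst U)\<^sup>2"
  proof (rule mult_mono)
    show "snd X \<bullet> snd X \<le> (fst X)\<^sup>2" using assms(2) by (simp add: mink_def power2_eq_square)
    show "snd U \<bullet> snd U \<le> (fst U)\<^sup>2" using U(2) by simp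
  qed simp_all
  finally have "\<bar>snd X \<bullet> snd U\<bar> \<le> \<bar>fst X * fst U\<bar>"
    by (simp add: abs_le_square_iff power_mult_distrib)
  also have "\<dots> = - (fst X * fst U)"
    using X0 U by (simp add: abs_mult mult_nonpos_nonneg)
  finally show False using assms(3) by (simp add: mink_def)
qed

text \<open>The orthogonal complement of a timelike vector is definite, so it contains no null vector but zero.\<close>

lemma null_orthogonal_imp_0:
  assumes "U \<in> hyperboloid" "mink Z Z = 0" "mink Z U = 0"
  shows "Z = 0"
proof -
  have U: "snd U \<bullet> snd U = (fst U)\<^sup>2 - 1"
    using assms(1) by (auto simp: hyperboloid_def mink_def power2_eq_square)
  have Z: "snd Z \<bullet> snd Z = (fst Z)\<^sup>2" "snd Z \<bullet> snd U = fst Z * fst U"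
    using assms by (auto simp: mink_def power2_eq_square)
  have "(fst Z * fst U)\<^sup>2 \<le> (fst Z)\<^sup>2 * ((fst U)\<^sup>2 - 1)"
    using Cauchy_Schwarz_ineq[of "snd Z" "snd U"] by (simp add: U Z)
  then have "fst Z = 0" by (simp add: algebra_simps power_mult_distrib)
  with Z show ?thesis by (simp add: prod_eq_iff)
qed

lemma mink_ge_1:
  assumes "X \<in> hyperboloid" "Y \<in> hyperboloid" shows "mink X Y \<ge> 1"
proof -
  obtain a x b y where XY: "X = (a, x)" "Y = (b, y)" by (cases X, cases Y) auto
  have a: "a > 0" "x \<bullet> x = a\<^sup>2 - 1" and b: "b > 0" "y \<bullet> y = b\<^sup>2 - 1"
    using assms by (auto simp: XY hyperboloid_def mink_def power2_eq_square)
  have "1\<^sup>2 \<le> a\<^sup>2" "1\<^sup>2 \<le> b\<^sup>2"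
    using a b inner_ge_zero[of x] inner_ge_zero[of y] by auto
  then have "a \<ge> 1" "b \<ge> 1"
    using a b power2_le_imp_le[of 1 a] power2_le_imp_le[of 1 b] by simp_all
  then have ab: "a * b \<ge> 1" using mult_mono[of 1 a 1 b] by simp
  have "(x \<bullet> y)\<^sup>2 \<le> (a\<^sup>2 - 1) * (b\<^sup>2 - 1)" using Cauchy_Schwarz_ineq[of x y] by (simp add: a b)
  also have "\<dots> = (a * b - 1)\<^sup>2 - (a - b)\<^sup>2" by (simp add: power2_eq_square algebra_simps)
  also have "\<dots> \<le> (a * b - 1)\<^sup>2" by simp
  finally have "x \<bullet> y \<le> a * b - 1" by (rule power2_le_imp_le) (use ab in simp)
  then show ?thesis by (simp add: XY mink_def)
qed

text \<open>If \<open>mink X Y = 1\<close> then \<open>X - Y\<close> is null and orthogonal to \<open>X\<close>. This rigidity is what makes geodesics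
  unique.\<close>

lemma mink_eq_1_iff:
  assumes "X \<in> hyperboloid" "Y \<in> hyperboloid" shows "mink X Y = 1 \<longleftrightarrow> X = Y"
proof
  assume "mink X Y = 1"
  with assms have "X - Y = 0"
    by (intro null_orthogonal_imp_0[of X]) (auto simp: mink_linear mink_commute[of Y X] hyperboloid_def)
  then show "X = Y" by simp
qed (use assms in \<open>auto simp: hyperboloid_def\<close>)

lemma cosh_hdist:
  assumes "u \<in> H3" "v \<in> H3"
  shows "cosh (hdist u v) = mink (lift u) (lift v)" "hdist u v \<ge> 0"
proof -
  define m n where "m = (norm u)\<^sup>2" and "n = (norm v)\<^sup>2"
  have mn: "m < 1" "n < 1" using assms by (simp_all add: m_def n_def H3_norm)
  have d: "(norm (u - v))\<^sup>2 = m + n - 2 * (u \<bullet> v)"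
    by (simp add: m_def n_def power2_norm_eq_inner inner_simps inner_commute[of v u])
  have "mink (lift u) (lift v) = ((1 + m) * (1 + n) - 4 * (u \<bullet> v)) / ((1 - m) * (1 - n))"
    by (simp add: mink_def lift_def diff_divide_distrib flip: m_def n_def)
  also have "\<dots> = 1 + 2 * (norm (u - v))\<^sup>2 / ((1 - m) * (1 - n))"
    using mn by (simp add: d divide_simps) (simp add: algebra_simps)
  finally have "hdist u v = arcosh (mink (lift u) (lift v))"
    by (simp add: hdist_def m_def n_def)
  then show "cosh (hdist u v) = mink (lift u) (lift v)" "hdist u v \<ge> 0"
    using mink_ge_1[OF lift_in_hyperboloid[OF assms(1)] lift_in_hyperboloid[OF assms(2)]] by auto
qed

lemma hdist_pos:
  assumes "u \<in> H3" "v \<in> H3" "u \<noteq> v" shows "hdist u v > 0"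
proof -
  have "lift u \<noteq> lift v" using to_ball_lift assms by metis
  then have "cosh (hdist u v) \<noteq> 1"
    using mink_eq_1_iff[OF lift_in_hyperboloid lift_in_hyperboloid] assms cosh_hdist by auto
  then show ?thesis using cosh_hdist(2)[OF assms(1,2)] by (cases "hdist u v = 0") auto
qed

section \<open>Geodesics and ends of rays\<close>

text \<open>The combination of \<open>U\<close> and \<open>V\<close> that runs through \<open>U\<close> at time \<open>0\<close> and through \<open>V\<close> at time \<open>d\<close>; it has unit
  speed when \<open>d\<close> is the distance of the two points.\<close>

definition hyp_line :: "real \<Rightarrow> spacetime \<Rightarrow> spacetime \<Rightarrow> real \<Rightarrow> spacetime" where
  "hyp_line d U V s = (sinh s / sinh d) *\<^sub>R V + (sinh (d - s) / sinh d) *\<^sub>R U"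

lemma hyp_line_endpoints:
  assumes "d > 0" shows "hyp_line d U V 0 = U" "hyp_line d U V d = V"
  using assms by (simp_all add: hyp_line_def)

context
  fixes U V :: "spacetime" and d :: real
  assumes U: "U \<in> hyperboloid" and V: "V \<in> hyperboloid" and d: "d > 0" and UV: "mink U V = cosh d"
begin

lemma mink_hyp_line: "mink (hyp_line d U V s) (hyp_line d U V t) = cosh (s - t)"
proof -
  have sd: "sinh d \<noteq> 0" using d by simp
  have UU: "mink U U = 1" and VV: "mink V V = 1" and VU: "mink V U = cosh d"
    using U V UV by (auto simp: hyperboloid_def mink_commute)
  have "mink (hyp_line d U V s) (hyp_line d U V t) =
    (sinh s * sinh t + sinh (d - s) * sinh (d - t) + (sinh s * sinh (d - t) + sinh t * sinh (d - s)) * cosh d) / (sinh d)\<^sup>2"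
    unfolding hyp_line_def mink_linear UU VV VU UV using sd
    by (simp add: divide_simps power2_eq_square) (simp add: algebra_simps)
  also have "\<dots> = cosh (s - t)"
  proof -
    have "cosh d ^ 2 = 1 + sinh d ^ 2" "cosh s ^ 2 = 1 + sinh s ^ 2" "cosh t ^ 2 = 1 + sinh t ^ 2"
      by (simp_all add: cosh_square_eq)
    then have "sinh s * sinh t + sinh (d - s) * sinh (d - t) + (sinh s * sinh (d - t) + sinh t * sinh (d - s)) * cosh d
      = cosh (s - t) * (sinh d)\<^sup>2"
      unfolding sinh_diff cosh_diff by Groebner_Basis.algebra
    then show ?thesis using sd by simp
  qed
  finally show ?thesis .
qed

text \<open>The line stays on the upper sheet because its product with the point \<open>U\<close> of that sheet is \<open>cosh s > 0\<close>.\<close>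

lemma hyp_line_in_hyperboloid: "hyp_line d U V s \<in> hyperboloid"
proof -
  have "mink (hyp_line d U V s) U = cosh s"
    using mink_hyp_line[of s 0] d by (simp add: hyp_line_endpoints)
  then have "fst (hyp_line d U V s) > 0"
    using mink_hyp_line[of s s] by (intro future_directed[OF U]) auto
  then show ?thesis using mink_hyp_line[of s s] by (simp add: hyperboloid_def)
qed

lemma geodesic_on_hyp_line: "geodesic_on I (\<lambda>s. to_ball (hyp_line d U V s))"
  unfolding geodesic_on_def
proof (intro conjI ballI)
  note L = to_ball_hyperboloid[OF hyp_line_in_hyperboloid]
  show "(\<lambda>s. to_ball (hyp_line d U V s)) ` I \<subseteq> H3" using L(1) by blast
  fix s t
  let ?h = "hdist (to_ball (hyp_line d U V s)) (to_ball (hyp_line d U V t))"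
  have "?h = arcosh (cosh ?h)"
    using cosh_hdist(2)[OF L(1) L(1)] by (rule arcosh_cosh_real[symmetric])
  also have "cosh ?h = cosh \<bar>s - t\<bar>"
    unfolding cosh_hdist(1)[OF L(1) L(1)] L(2) mink_hyp_line by simp
  also have "arcosh (cosh \<bar>s - t\<bar>) = \<bar>s - t\<bar>" by (rule arcosh_cosh_real) simp
  finally show "?h = \<bar>s - t\<bar>" .
qed

end

text \<open>A point of the hyperboloid whose products with \<open>U\<close> and \<open>V\<close> agree with those of the point \<open>L s\<close> of the
  line has product \<open>1\<close> with \<open>L s\<close>, because \<open>L s\<close> is a combination of \<open>U\<close> and \<open>V\<close>. Hence it is \<open>L s\<close>.\<close>

lemma geodesic_unique:
  assumes g: "geodesic_on I \<gamma>" and I: "0 \<in> I" "d \<in> I" "s \<in> I" and d: "d > 0"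
  shows "lift (\<gamma> s) = hyp_line d (lift (\<gamma> 0)) (lift (\<gamma> d)) s"
proof -
  have H: "\<gamma> t \<in> H3" if "t \<in> I" for t using g that by (auto simp: geodesic_on_def)
  have m: "mink (lift (\<gamma> r)) (lift (\<gamma> t)) = cosh (r - t)" if "r \<in> I" "t \<in> I" for r t
    using cosh_hdist(1)[OF H H, OF that] g that by (auto simp: geodesic_on_def)
  define U V L where "U = lift (\<gamma> 0)" and "V = lift (\<gamma> d)" and "L = hyp_line d U V"
  have UV: "U \<in> hyperboloid" "V \<in> hyperboloid" "mink U V = cosh d"
    using H I m[of 0 d] by (auto simp: U_def V_def lift_in_hyperboloid)
  note l = mink_hyp_line[OF UV(1,2) d UV(3), folded L_def]
  have L0: "L 0 = U" and Ld: "L d = V" using d by (simp_all add: L_def hyp_line_endpoints)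
  have X: "mink (lift (\<gamma> s)) U = cosh s" "mink (lift (\<gamma> s)) V = cosh (s - d)" "mink (lift (\<gamma> s)) (lift (\<gamma> s)) = 1"
    using m I by (auto simp: U_def V_def)
  have XL: "mink (lift (\<gamma> s)) (L s) = 1"
  proof -
    have lin: "mink Y (L s) = sinh s / sinh d * mink Y V + sinh (d - s) / sinh d * mink Y U" for Y
      by (simp add: L_def hyp_line_def mink_linear)
    have "mink (lift (\<gamma> s)) (L s) = mink (L s) (L s)"
      unfolding lin X using l[of s 0] l[of s d] by (simp add: L0 Ld)
    then show ?thesis using l by simp
  qed
  have "lift (\<gamma> s) \<in> hyperboloid" "L s \<in> hyperboloid"
    using H I hyp_line_in_hyperboloid[OF UV(1,2) d UV(3)] by (auto simp: L_def lift_in_hyperboloid)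
  then show ?thesis using XL mink_eq_1_iff by (simp add: L_def U_def V_def)
qed


text \<open>Along the line through \<open>U\<close> and \<open>V\<close> the coefficients of \<open>V\<close> and \<open>U\<close> grow like \<open>e\<^sup>s\<close> and \<open>- e\<^sup>s\<^sup>-\<^sup>d\<close> with the
  same constant, so the direction of the ray tends to that of the null vector \<open>V - e\<^sup>-\<^sup>d U\<close>.\<close>

lemma ray_end_eq:
  fixes u v :: "real ^ 3"
  assumes u: "u \<in> H3" and v: "v \<in> H3" and "u \<noteq> v"
  defines "N \<equiv> lift v - exp (- hdist u v) *\<^sub>R lift u"
  shows "fst N > 0" "mink N N = 0" "ray_end u v = (1 / fst N) *\<^sub>R snd N"
proof -
  define U V d where "U = lift u" and "V = lift v" and "d = hdist u v"
  have d: "d > 0" using hdist_pos assms by (simp add: d_def)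
  have UV: "U \<in> hyperboloid" "V \<in> hyperboloid" "mink U V = cosh d"
    using u v by (simp_all add: U_def V_def d_def lift_in_hyperboloid cosh_hdist)
  have N: "N = V - exp (- d) *\<^sub>R U" by (simp add: N_def U_def V_def d_def)
  have m: "mink U U = 1" "mink V V = 1" "mink V U = cosh d"
    using UV by (auto simp: hyperboloid_def mink_commute)
  have e: "exp (- d) * cosh d = (1 + (exp (- d))\<^sup>2) / 2"
    by (simp add: cosh_def power2_eq_square distrib_left flip: exp_add)
  show null: "mink N N = 0"
    using e by (simp add: N mink_linear m UV(3) power2_eq_square field_simps)
  have "mink N V = (1 - (exp (- d))\<^sup>2) / 2"
    using e by (simp add: N mink_linear m UV(3) field_simps)
  moreover have "(exp (- d))\<^sup>2 < 1" using d by (simp add: power2_eq_square flip: exp_add)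
  ultimately show pos: "fst N > 0" using null by (intro future_directed[OF UV(2)]) auto
  define L where "L = hyp_line d U V"
  have lim: "((\<lambda>s. to_ball (L s)) \<longlongrightarrow> (1 / fst N) *\<^sub>R snd N) at_top"
  proof -
    have e0: "((\<lambda>s::real. exp (- s)) \<longlongrightarrow> 0) at_top"
      by (rule filterlim_compose[OF exp_at_bot filterlim_uminus_at_bot_at_top])
    have "((\<lambda>s. (((1 - exp (- s) * exp (- s)) / 2) / sinh d) *\<^sub>R V
        + (((exp d * (exp (- s) * exp (- s)) - exp (- d)) / 2) / sinh d) *\<^sub>R U) \<longlongrightarrow>
      ((1 - 0 * 0) / 2 / sinh d) *\<^sub>R V + ((exp d * (0 * 0) - exp (- d)) / 2 / sinh d) *\<^sub>R U) at_top"
      using d by (intro tendsto_intros e0) auto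
    also have "((1 - 0 * 0) / 2 / sinh d) *\<^sub>R V + ((exp d * (0 * 0) - exp (- d)) / 2 / sinh d) *\<^sub>R U
        = (1 / (2 * sinh d)) *\<^sub>R N"
      by (simp add: N algebra_simps)
    also have "(\<lambda>s. (((1 - exp (- s) * exp (- s)) / 2) / sinh d) *\<^sub>R V
        + (((exp d * (exp (- s) * exp (- s)) - exp (- d)) / 2) / sinh d) *\<^sub>R U) = (\<lambda>s. exp (- s) *\<^sub>R L s)"
    proof
      fix s :: real
      have "exp (- s) * sinh s = (1 - exp (- s) * exp (- s)) / 2"
        by (simp add: sinh_field_def right_diff_distrib diff_divide_distrib flip: exp_add)
      moreover have "exp (- s) * sinh (d - s) = (exp d * (exp (- s) * exp (- s)) - exp (- d)) / 2"
        by (simp add: sinh_field_def right_diff_distrib diff_divide_distrib flip: exp_add)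
      ultimately show "(((1 - exp (- s) * exp (- s)) / 2) / sinh d) *\<^sub>R V
        + (((exp d * (exp (- s) * exp (- s)) - exp (- d)) / 2) / sinh d) *\<^sub>R U = exp (- s) *\<^sub>R L s"
        by (simp only: L_def hyp_line_def scaleR_add_right scaleR_scaleR times_divide_eq_right)
    qed
    finally have E: "((\<lambda>s. exp (- s) *\<^sub>R L s) \<longlongrightarrow> (1 / (2 * sinh d)) *\<^sub>R N) at_top" .
    define c where "c = 1 / (2 * sinh d)"
    have c: "c > 0" using d by (simp add: c_def)
    define M where "M = (\<lambda>s. exp (- s) *\<^sub>R L s)"
    have M: "(M \<longlongrightarrow> c *\<^sub>R N) at_top" using E by (simp add: M_def c_def)
    have "((\<lambda>s. (1 / (exp (- s) + fst (M s))) *\<^sub>R snd (M s)) \<longlongrightarrow>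
        (1 / (0 + fst (c *\<^sub>R N))) *\<^sub>R snd (c *\<^sub>R N)) at_top"
      using c pos by (intro tendsto_intros e0 M) simp
    also have "(1 / (0 + fst (c *\<^sub>R N))) *\<^sub>R snd (c *\<^sub>R N) = (1 / fst N) *\<^sub>R snd N"
      using c by simp
    also have "(\<lambda>s. (1 / (exp (- s) + fst (M s))) *\<^sub>R snd (M s)) = (\<lambda>s. to_ball (L s))"
    proof
      fix s
      have "exp (- s) + fst (M s) = exp (- s) * (1 + fst (L s))" by (simp add: M_def algebra_simps)
      then show "(1 / (exp (- s) + fst (M s))) *\<^sub>R snd (M s) = to_ball (L s)"
        by (simp add: to_ball_def M_def)
    qed
    finally show ?thesis .
  qed
  show "ray_end u v = (1 / fst N) *\<^sub>R snd N"
    unfolding ray_end_def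
  proof (rule the_equality)
    show "\<exists>\<gamma>. geodesic_on {0..} \<gamma> \<and> \<gamma> 0 = u \<and> v \<in> \<gamma> ` {0..} \<and> (\<gamma> \<longlongrightarrow> (1 / fst N) *\<^sub>R snd N) at_top"
    proof (intro exI conjI)
      show "geodesic_on {0..} (\<lambda>s. to_ball (L s))"
        unfolding L_def by (rule geodesic_on_hyp_line[OF UV(1,2) d UV(3)])
      show "to_ball (L 0) = u" using d u by (simp add: L_def hyp_line_endpoints U_def to_ball_lift)
      have "v = to_ball (L d)" using d v by (simp add: L_def hyp_line_endpoints V_def to_ball_lift)
      then show "v \<in> (\<lambda>s. to_ball (L s)) ` {0..}" using d by auto
    qed (rule lim)
  next
    fix \<xi>
    assume "\<exists>\<gamma>. geodesic_on {0..} \<gamma> \<and> \<gamma> 0 = u \<and> v \<in> \<gamma> ` {0..} \<and> (\<gamma> \<longlongrightarrow> \<xi>) at_top"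
    then obtain \<gamma> r where \<gamma>: "geodesic_on {0..} \<gamma>" "\<gamma> 0 = u" "(\<gamma> \<longlongrightarrow> \<xi>) at_top" and r: "r \<ge> 0" "v = \<gamma> r"
      by auto
    have "d = r" using \<gamma> r by (auto simp: d_def geodesic_on_def)
    have "\<gamma> s = to_ball (L s)" if "s \<ge> 0" for s
    proof -
      have "lift (\<gamma> s) = L s"
        using geodesic_unique[OF \<gamma>(1), of d s] that r d \<gamma>(2) \<open>d = r\<close> by (simp add: L_def U_def V_def)
      moreover have "\<gamma> s \<in> H3" using \<gamma>(1) that by (auto simp: geodesic_on_def)
      ultimately show ?thesis using to_ball_lift by metis
    qed
    then have "\<forall>\<^sub>F s in at_top. to_ball (L s) = \<gamma> s"
      by (intro eventually_mono[OF eventually_ge_at_top[of 0]]) auto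
    then have "(\<gamma> \<longlongrightarrow> (1 / fst N) *\<^sub>R snd N) at_top" using lim by (rule Lim_transform_eventually[rotated])
    then show "\<xi> = (1 / fst N) *\<^sub>R snd N" using \<gamma>(3) tendsto_unique trivial_limit_at_top_linorder by blast
  qed
qed

section \<open>Geodesic segments and triangles in convex sets\<close>

text \<open>Every point of the hyperboloid that is a nonnegative combination of two others lies on the segment
  between them, at the time \<open>s\<close> that solves \<open>sinh s = \<beta> sinh d\<close>.\<close>

lemma hyp_convex_segment:
  assumes C: "hyp_convex C" "u \<in> C" "v \<in> C" and w: "w \<in> H3"
    and "\<alpha> \<ge> 0" "\<beta> \<ge> 0" and W: "lift w = \<alpha> *\<^sub>R lift u + \<beta> *\<^sub>R lift v"
  shows "w \<in> C"
proof (cases "u = v")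
  case True
  have "u \<in> H3" using C by (auto simp: hyp_convex_def)
  then have "mink (lift w) (lift w) = (\<alpha> + \<beta>)\<^sup>2"
    using lift_in_hyperboloid[of u]
    by (simp add: W True mink_linear hyperboloid_def power2_eq_square algebra_simps)
  then have "\<alpha> + \<beta> = 1"
    using lift_in_hyperboloid[OF w] assms(5,6) power2_eq_1_iff[of "\<alpha> + \<beta>"] by (auto simp: hyperboloid_def)
  then have "lift w = lift u" by (simp add: W True flip: scaleR_add_left)
  then show ?thesis using to_ball_lift w \<open>u \<in> H3\<close> C(2) by metis
next
  case False
  define d where "d = hdist u v"
  have H: "u \<in> H3" "v \<in> H3" using C by (auto simp: hyp_convex_def)
  then have d: "d > 0" using False by (simp add: d_def hdist_pos)
  have UV: "lift u \<in> hyperboloid" "lift v \<in> hyperboloid" "mink (lift u) (lift v) = cosh d"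
    using H by (simp_all add: lift_in_hyperboloid cosh_hdist d_def)
  define s where "s = arsinh (\<beta> * sinh d)"
  have s: "sinh s = \<beta> * sinh d" by (simp add: s_def)
  have "mink (lift w) (lift w) = \<alpha>\<^sup>2 + \<beta>\<^sup>2 + 2 * \<alpha> * \<beta> * cosh d"
    using UV by (simp add: W mink_linear mink_commute[of "lift v" "lift u"] hyperboloid_def power2_eq_square algebra_simps)
  then have q: "\<alpha>\<^sup>2 + \<beta>\<^sup>2 + 2 * \<alpha> * \<beta> * cosh d = 1"
    using lift_in_hyperboloid[OF w] by (simp add: hyperboloid_def)
  have "(cosh s)\<^sup>2 = 1 + \<beta>\<^sup>2 * (sinh d)\<^sup>2" by (simp add: cosh_square_eq s power_mult_distrib)
  also have "\<dots> = (\<alpha> + \<beta> * cosh d)\<^sup>2"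
    using q cosh_square_eq[of d] by Groebner_Basis.algebra
  finally have c: "cosh s = \<alpha> + \<beta> * cosh d"
    using assms(5,6) by (simp add: power2_eq_iff_nonneg)
  have ds: "sinh (d - s) = \<alpha> * sinh d" by (simp add: sinh_diff s c algebra_simps)
  have "sinh s \<ge> 0" "sinh (d - s) \<ge> 0" unfolding s ds using assms(5,6) d by simp_all
  then have "s \<ge> 0" "d - s \<ge> 0" by (simp_all only: sinh_real_nonneg_iff)
  moreover have "hyp_line d (lift u) (lift v) s = lift w" using d by (simp add: hyp_line_def s ds W add.commute)
  then have "to_ball (hyp_line d (lift u) (lift v) s) = w" using to_ball_lift w by simp
  moreover have "(\<lambda>s. to_ball (hyp_line d (lift u) (lift v) s)) ` {0..d} \<subseteq> C"
  proof -
    have "geodesic_on {0..d} (\<lambda>s. to_ball (hyp_line d (lift u) (lift v) s))"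
      by (rule geodesic_on_hyp_line[OF UV(1,2) d UV(3)])
    moreover have "to_ball (hyp_line d (lift u) (lift v) 0) \<in> C" "to_ball (hyp_line d (lift u) (lift v) d) \<in> C"
      using C H d by (simp_all add: hyp_line_endpoints to_ball_lift)
    ultimately show ?thesis using C(1) by (simp add: hyp_convex_def)
  qed
  ultimately show ?thesis by auto
qed

text \<open>The combination of \<open>v\<close> and \<open>z\<close>, rescaled to the hyperboloid, is a point of the side \<open>vz\<close>, and \<open>w\<close> lies
  on the segment from \<open>u\<close> to that point.\<close>

lemma hyp_convex_triangle:
  assumes C: "hyp_convex C" "u \<in> C" "v \<in> C" "z \<in> C" and w: "w \<in> H3"
    and pos: "\<alpha> \<ge> 0" "\<beta> \<ge> 0" "\<gamma> \<ge> 0"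
    and W: "lift w = \<alpha> *\<^sub>R lift u + \<beta> *\<^sub>R lift v + \<gamma> *\<^sub>R lift z"
  shows "w \<in> C"
proof (cases "\<beta> = 0 \<and> \<gamma> = 0")
  case True
  then show ?thesis using hyp_convex_segment[OF C(1,2,2) w, of \<alpha> 0] pos W by simp
next
  case False
  have H: "v \<in> H3" "z \<in> H3" using C by (auto simp: hyp_convex_def)
  define Y m where "Y = \<beta> *\<^sub>R lift v + \<gamma> *\<^sub>R lift z" and "m = sqrt (mink Y Y)"
  have vz: "lift v \<in> hyperboloid" "lift z \<in> hyperboloid" using H by (simp_all add: lift_in_hyperboloid)
  have "mink Y Y = \<beta>\<^sup>2 + \<gamma>\<^sup>2 + 2 * (\<beta> * \<gamma> * mink (lift v) (lift z))"
    using vz by (simp add: Y_def mink_linear mink_commute[of "lift z" "lift v"] hyperboloid_def power2_eq_square algebra_simps)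
  moreover have "\<beta> * \<gamma> * mink (lift v) (lift z) \<ge> 0"
    using pos mink_ge_1[OF vz] by simp
  moreover have "\<beta>\<^sup>2 + \<gamma>\<^sup>2 > 0" using False by (simp add: sum_power2_gt_zero_iff)
  ultimately have YY: "mink Y Y > 0" by linarith
  then have m: "m > 0" "m * m = mink Y Y" by (simp_all add: m_def)
  have Y0: "fst Y > 0"
  proof -
    have "fst (lift v) > 0" "fst (lift z) > 0" using vz by (auto simp: hyperboloid_def)
    then have "\<beta> * fst (lift v) \<ge> 0" "\<gamma> * fst (lift z) \<ge> 0" "\<beta> * fst (lift v) > 0 \<or> \<gamma> * fst (lift z) > 0"
      using False pos by (auto simp: zero_less_mult_iff)
    then show ?thesis by (auto simp: Y_def)
  qed
  define y where "y = to_ball ((1 / m) *\<^sub>R Y)"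
  have "(1 / m) *\<^sub>R Y \<in> hyperboloid" using m(1) Y0 by (simp add: hyperboloid_def mink_linear m(2)[symmetric])
  then have y: "y \<in> H3" "lift y = (1 / m) *\<^sub>R Y" by (simp_all add: y_def to_ball_hyperboloid)
  have "y \<in> C"
  proof (rule hyp_convex_segment[OF C(1,3,4) y(1)])
    show "lift y = (\<beta> / m) *\<^sub>R lift v + (\<gamma> / m) *\<^sub>R lift z"
      by (simp add: y Y_def scaleR_add_right)
  qed (use m pos in auto)
  then show ?thesis
  proof (rule hyp_convex_segment[OF C(1,2) _ w pos(1)])
    show "lift w = \<alpha> *\<^sub>R lift u + m *\<^sub>R lift y" using m by (simp add: W y Y_def add.assoc)
  qed (use m in auto)
qed

section \<open>The determinant as a polynomial in brackets\<close>

text \<open>Expansion along the first column, in a form that the simplifier can iterate on matrices of fixed size.\<close>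

lemma det_mat_Suc:
  fixes f :: "nat \<times> nat \<Rightarrow> 'a :: comm_ring_1"
  shows "Determinant.det (Matrix.mat (Suc n) (Suc n) f) =
    (\<Sum>i<Suc n. f (i, 0) * ((-1) ^ i * Determinant.det (Matrix.mat n n
       (\<lambda>(a, b). f (if a < i then a else Suc a, Suc b)))))"
proof -
  have "mat_delete (Matrix.mat (Suc n) (Suc n) f) i 0 =
      Matrix.mat n n (\<lambda>(a, b). f (if a < i then a else Suc a, Suc b))" for i
    by (rule eq_matI) (auto simp: mat_delete_def)
  then show ?thesis
    by (subst laplace_expansion_column[where j = 0 and n = "Suc n"])
      (auto simp: Determinant.cofactor_def intro!: sum.cong)
qed

lemma poly_det_2: "poly_det [[:a, b:], [:c, d:]] = a * d - b * c"
  by (simp add: poly_det_def det_mat_Suc numeral_2_eq_2)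

definition bracket :: "'a \<times> 'a \<Rightarrow> 'a \<times> 'a \<Rightarrow> 'a :: comm_ring_1" where
  "bracket u v = fst u * snd v - snd u * fst v"

definition linear_form :: "'a \<times> 'a \<Rightarrow> 'a :: comm_ring_1 poly" where
  "linear_form v = [:- fst v, snd v:]"

lemma poly_det_linear_forms: "poly_det [linear_form u, linear_form v] = - bracket u v"
  by (simp add: linear_form_def poly_det_2 bracket_def)

text \<open>The identity that carries the whole inequality. The first product of brackets is the denominator of
  the Atiyah-Sutcliffe determinant. The other ten form a union of orbits under the cyclic relabelling
  \<open>1, 2, 3, 4\<close> to \<open>2, 3, 4, 1\<close> (two orbits of one element, two of four). In every
  product the twelve vectors are matched in pairs, and none of the pairs consists of two vectors of the
  same arc. Hence all eleven products are positive once the vectors are in cyclic order.\<close>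

lemma poly_det_cubics:
  fixes w :: "nat \<Rightarrow> nat \<Rightarrow> complex \<times> complex"
  defines "l \<equiv> \<lambda>a b. linear_form (w a b)" and "B \<equiv> \<lambda>a b c d. bracket (w a b) (w c d)"
  shows "poly_det [l 1 2 * l 1 3 * l 1 4, l 2 1 * l 2 3 * l 2 4, l 3 1 * l 3 2 * l 3 4, l 4 1 * l 4 2 * l 4 3] =
    - (B 3 1 1 3 * B 4 1 1 4 * B 3 2 2 3 * B 4 2 2 4 * B 1 2 2 1 * B 4 3 3 4
     + B 3 1 2 1 * B 4 1 2 3 * B 3 2 4 2 * B 1 2 3 4 * B 4 3 1 3 * B 1 4 2 4
     + B 3 1 4 1 * B 3 2 1 4 * B 4 2 1 2 * B 4 3 2 1 * B 1 3 2 3 * B 2 4 3 4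
     + B 3 1 4 1 * B 3 2 2 3 * B 4 2 2 1 * B 1 2 3 4 * B 4 3 1 3 * B 1 4 2 4
     + B 3 1 2 1 * B 4 1 2 3 * B 3 2 1 3 * B 4 2 1 2 * B 4 3 3 4 * B 1 4 2 4
     + B 3 1 2 1 * B 4 1 1 4 * B 3 2 4 2 * B 1 2 3 4 * B 4 3 2 4 * B 1 3 2 3
     + B 3 1 1 4 * B 4 1 2 3 * B 3 2 4 2 * B 1 2 2 1 * B 4 3 1 3 * B 2 4 3 4
     + B 3 1 4 1 * B 3 2 2 3 * B 4 2 1 2 * B 4 3 3 4 * B 1 3 2 1 * B 1 4 2 4
     + B 3 1 2 1 * B 4 1 1 4 * B 3 2 2 4 * B 4 2 1 2 * B 4 3 3 4 * B 1 3 2 3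
     + B 3 1 4 3 * B 4 1 1 4 * B 3 2 4 2 * B 1 2 2 1 * B 1 3 2 3 * B 2 4 3 4
     + B 3 1 4 1 * B 3 2 2 3 * B 4 2 1 4 * B 1 2 2 1 * B 4 3 1 3 * B 2 4 3 4)"
proof -
  define p q where "p = (\<lambda>a b. fst (w a b))" and "q = (\<lambda>a b. snd (w a b))"
  have l: "l a b = [:- p a b, q a b:]" for a b
    by (simp add: l_def linear_form_def p_def q_def)
  have B: "B a b c d = p a b * q c d - q a b * p c d" for a b c d
    by (simp add: B_def bracket_def p_def q_def)
  have cubic: "l a b * l a c * l a d =
      [:- (p a b * p a c * p a d), q a b * p a c * p a d + p a b * q a c * p a d + p a b * p a c * q a d,
        - (q a b * q a c * p a d + q a b * p a c * q a d + p a b * q a c * q a d), q a b * q a c * q a d:]"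
    for a b c d
    by (simp add: l algebra_simps)
  have det4: "poly_det [[:a0, a1, a2, a3:], [:b0, b1, b2, b3:], [:c0, c1, c2, c3:], [:d0, d1, d2, d3:]] =
      (a0 * b1 - a1 * b0) * (c2 * d3 - c3 * d2) - (a0 * b2 - a2 * b0) * (c1 * d3 - c3 * d1)
    + (a0 * b3 - a3 * b0) * (c1 * d2 - c2 * d1) + (a1 * b2 - a2 * b1) * (c0 * d3 - c3 * d0)
    - (a1 * b3 - a3 * b1) * (c0 * d2 - c2 * d0) + (a2 * b3 - a3 * b2) * (c0 * d1 - c1 * d0)"
    for a0 a1 a2 a3 b0 b1 b2 b3 c0 c1 c2 c3 d0 d1 d2 d3
    by (simp add: poly_det_def det_mat_Suc numeral_eq_Suc algebra_simps)
  show ?thesis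
    unfolding cubic det4 B by Groebner_Basis.algebra
qed

lemma p_point_4:
  "p_point 4 x 1 = p_pair x 1 2 * p_pair x 1 3 * p_pair x 1 4"
  "p_point 4 x 2 = p_pair x 2 1 * p_pair x 2 3 * p_pair x 2 4"
  "p_point 4 x 3 = p_pair x 3 1 * p_pair x 3 2 * p_pair x 3 4"
  "p_point 4 x 4 = p_pair x 4 1 * p_pair x 4 2 * p_pair x 4 3"
proof -
  have "{1..4} - {1} = {2,3,4::nat}" "{1..4} - {2} = {1,3,4::nat}"
    "{1..4} - {3} = {1,2,4::nat}" "{1..4} - {4} = {1,2,3::nat}" by auto
  then show
    "p_point 4 x 1 = p_pair x 1 2 * p_pair x 1 3 * p_pair x 1 4"
    "p_point 4 x 2 = p_pair x 2 1 * p_pair x 2 3 * p_pair x 2 4"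
    "p_point 4 x 3 = p_pair x 3 1 * p_pair x 3 2 * p_pair x 3 4"
    "p_point 4 x 4 = p_pair x 4 1 * p_pair x 4 2 * p_pair x 4 3"
    by (simp_all add: p_point_def mult.assoc)
qed

lemma pairs_4: "{(a, b). 1 \<le> a \<and> a < b \<and> b \<le> 4} =
  {(1, 2), (1, 3), (1, 4), (2, 3), (2, 4), (3, 4 :: nat)}"
  by auto

section \<open>Relabelling the points\<close>

lemma poly_det_2_commute: "cmod (poly_det [p, q]) = cmod (poly_det [q, p])"
proof -
  have "poly_det [p, q] = - poly_det [q, p]"
    by (simp add: poly_det_def det_mat_Suc numeral_2_eq_2)
  then show ?thesis by simp
qed

lemma cmod_poly_det_permute:
  assumes "\<pi> permutes {1..n}"
  shows "cmod (poly_det (map (\<lambda>a. P (\<pi> a)) [1..<Suc n])) = cmod (poly_det (map P [1..<Suc n]))"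
proof -
  define \<sigma> where "\<sigma> j = (if j < n then \<pi> (Suc j) - 1 else j)" for j
  have in_range: "\<pi> (Suc j) \<in> {1..n}" if "j < n" for j
    using permutes_in_image[OF assms, of "Suc j"] that by simp
  have \<sigma>: "\<sigma> permutes {0..<n}"
  proof (rule bij_imp_permutes)
    have "inj_on \<sigma> {0..<n}"
    proof (rule inj_onI)
      fix i j assume ij: "i \<in> {0..<n}" "j \<in> {0..<n}" "\<sigma> i = \<sigma> j"
      then have "\<pi> (Suc i) = \<pi> (Suc j)" using in_range[of i] in_range[of j] by (auto simp: \<sigma>_def)
      then show "i = j" using permutes_inj[OF assms] by (auto dest: injD)
    qed
    moreover have "\<sigma> ` {0..<n} \<subseteq> {0..<n}" using in_range by (fastforce simp: \<sigma>_def)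
    ultimately show "bij_betw \<sigma> {0..<n} {0..<n}"
      by (simp add: bij_betw_def endo_inj_surj)
  qed (simp add: \<sigma>_def)
  define A where "A = Matrix.mat n n (\<lambda>(i, j). coeff (P (Suc i)) j)"
  have A: "A \<in> carrier_mat n n" by (simp add: A_def)
  have nth: "[Suc 0..<Suc n] ! j = Suc j" if "j < n" for j using that by (simp del: upt_Suc)
  have "poly_det (map P [1..<Suc n]) = Determinant.det (transpose_mat A)"
    unfolding poly_det_def A_def by (intro arg_cong[of _ _ Determinant.det] eq_matI) (auto simp: nth simp del: upt_Suc)
  moreover have "poly_det (map (\<lambda>a. P (\<pi> a)) [1..<Suc n]) =
      Determinant.det (transpose_mat (Matrix.mat n n (\<lambda>(i, j). A $$ (\<sigma> i, j))))"
    unfolding poly_det_def A_def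
  proof (intro arg_cong[of _ _ Determinant.det] eq_matI, goal_cases)
    case (1 i j)
    then have "Suc (\<sigma> j) = \<pi> (Suc j)" "\<sigma> j < n" using in_range[of j] by (auto simp: \<sigma>_def)
    with 1 show ?case by (auto simp: nth simp del: upt_Suc)
  qed auto
  moreover have "Determinant.det (transpose_mat (Matrix.mat n n (\<lambda>(i, j). A $$ (\<sigma> i, j)))) =
      signof \<sigma> * Determinant.det (transpose_mat A)"
    using det_permute_rows[OF A \<sigma>] det_transpose[OF A]
      det_transpose[of "Matrix.mat n n (\<lambda>(i, j). A $$ (\<sigma> i, j))" n] by simp
  moreover have "cmod (signof \<sigma>) = 1" by (simp add: sign_def)
  ultimately show ?thesis by (simp add: norm_mult)
qed

text \<open>A relabelling permutes the columns of the numerator and the factors of the denominator, the latter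
  after an exchange of the two columns in some factors. Both cost only signs.\<close>

lemma cmod_AS_det_permute:
  assumes \<pi>: "\<pi> permutes {1..n}"
  shows "cmod (AS_det n (x \<circ> \<pi>)) = cmod (AS_det n x)"
proof -
  have pair: "p_pair (x \<circ> \<pi>) a b = p_pair x (\<pi> a) (\<pi> b)" for a b
    by (simp add: p_pair_def t_end_def)
  have point: "p_point n (x \<circ> \<pi>) a = p_point n x (\<pi> a)" if "a \<in> {1..n}" for a
  proof -
    have "{1..n} - {\<pi> a} = \<pi> ` ({1..n} - {a})"
      using permutes_image[OF \<pi>] permutes_inj[OF \<pi>] by (auto simp: image_set_diff)
    then show ?thesis
      unfolding p_point_def pair using permutes_inj[OF \<pi>]
      by (simp add: prod.reindex inj_on_subset o_def)
  qed
  have "map (p_point n (x \<circ> \<pi>)) [1..<Suc n] = map (\<lambda>a. p_point n x (\<pi> a)) [1..<Suc n]"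
    using point by (auto simp del: upt_Suc)
  then have num: "cmod (poly_det (map (p_point n (x \<circ> \<pi>)) [1..<Suc n])) = cmod (poly_det (map (p_point n x) [1..<Suc n]))"
    using cmod_poly_det_permute[OF \<pi>] by metis
  define S where "S = {(a, b). 1 \<le> a \<and> a < b \<and> b \<le> n}"
  define g where "g e = cmod (poly_det [p_pair x (fst e) (snd e), p_pair x (snd e) (fst e)])" for e
  \<comment> \<open>The action of a permutation on increasing pairs, which stand for two-element subsets.\<close>
  define swap where "swap r e = (min (r (fst e)) (r (snd e)), max (r (fst e)) (r (snd e)))"
    for r :: "nat \<Rightarrow> nat" and e
  have swap_S: "swap r e \<in> S" if "r permutes {1..n}" "e \<in> S" for r e
    using that permutes_in_image[OF that(1)] permutes_inj[OF that(1)]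
    by (fastforce simp: S_def swap_def min_def max_def inj_eq split: prod.splits)
  have swap_swap: "swap r (swap r' e) = e" if "r permutes {1..n}" "\<And>i. r (r' i) = i" "e \<in> S" for r r' e
    using that by (auto simp: S_def swap_def min_def max_def split: prod.splits)
  have "(\<Prod>e\<in>S. g (\<pi> (fst e), \<pi> (snd e))) = (\<Prod>e\<in>S. g e)"
  proof (rule prod.reindex_bij_witness[where i = "swap (Hilbert_Choice.inv \<pi>)" and j = "swap \<pi>"])
    fix e
    show "g (swap \<pi> e) = g (\<pi> (fst e), \<pi> (snd e))"
      by (auto simp: swap_def g_def min_def max_def poly_det_2_commute)
  qed (use \<pi> permutes_inv[OF \<pi>] in \<open>auto intro!: swap_S swap_swap simp: permutes_inverses\<close>)
  then have "cmod (\<Prod>(a, b)\<in>S. poly_det [p_pair (x \<circ> \<pi>) a b, p_pair (x \<circ> \<pi>) b a]) =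
      cmod (\<Prod>(a, b)\<in>S. poly_det [p_pair x a b, p_pair x b a])"
    by (simp add: pair g_def case_prod_unfold flip: prod_norm)
  then show ?thesis using num by (simp add: AS_det_def norm_divide S_def)
qed

section \<open>Vectors in cyclic order\<close>

lemma bracket_simps:
  fixes u v :: "real \<times> real"
  shows "bracket (u + u') v = bracket u v + bracket u' v" "bracket v (u + u') = bracket v u + bracket v u'"
    and "bracket (r *\<^sub>R u) v = r * bracket u v" "bracket v (r *\<^sub>R u) = r * bracket v u"
    and "bracket (- u) v = - bracket u v" "bracket v (- u) = - bracket v u" "bracket u u = 0"
  by (simp_all add: bracket_def ring_distribs mult_ac)

lemma bracket_commute: "bracket u v = - bracket v u"
  by (simp add: bracket_def algebra_simps)

lemma bracket_decompose:
  fixes a b w :: "real \<times> real"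
  shows "bracket a b *\<^sub>R w = bracket w b *\<^sub>R a + bracket a w *\<^sub>R b"
  by (simp add: bracket_def prod_eq_iff algebra_simps)

text \<open>The vectors \<open>D 0, \<dots>, D 4\<close> bound four consecutive sectors. Position \<open>2i\<close> stands for the direction \<open>D i\<close>
  itself and position \<open>2i + 1\<close> for the open sector between \<open>D i\<close> and \<open>D (i + 1)\<close>.\<close>

definition in_sector :: "(nat \<Rightarrow> real \<times> real) \<Rightarrow> nat \<Rightarrow> real \<times> real \<Rightarrow> bool" where
  "in_sector D m v \<longleftrightarrow> (if even m then v = D (m div 2)
     else \<exists>s>0. \<exists>t>0. v = s *\<^sub>R D (m div 2) + t *\<^sub>R D (Suc (m div 2)))"

text \<open>The application has \<open>D 4 = - D 0\<close>. This is why \<open>bracket (D 0) (D 4)\<close> is only required to be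
  nonnegative.\<close>

lemma bracket_sectors_pos:
  fixes D :: "nat \<Rightarrow> real \<times> real"
  assumes nonneg: "\<And>i j. i \<le> j \<Longrightarrow> j \<le> 4 \<Longrightarrow> bracket (D i) (D j) \<ge> 0"
    and pos: "\<And>i j. i < j \<Longrightarrow> j \<le> 3 \<Longrightarrow> bracket (D i) (D j) > 0" and last: "bracket (D 3) (D 4) > 0"
    and v: "in_sector D m v" and v': "in_sector D m' v'" and m: "m < m'" "m' < 8"
  shows "bracket v v' > 0"
proof -
  define i j where "i = m div 2" and "j = m' div 2"
  have ij: "i \<le> j" "j \<le> 3" using m by (auto simp: i_def j_def)
  show ?thesis
  proof (cases "even m")
    case em: True
    then have vi: "v = D i" using v by (simp add: in_sector_def i_def)
    show ?thesis
    proof (cases "even m'")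
      case True
      then have "i < j" using em m unfolding i_def j_def by presburger
      then show ?thesis using True v' vi pos ij by (simp add: in_sector_def j_def)
    next
      case False
      then obtain s t where st: "s > 0" "t > 0" "v' = s *\<^sub>R D j + t *\<^sub>R D (Suc j)"
        using v' by (auto simp: in_sector_def j_def)
      have "bracket (D i) (D j) > 0 \<or> bracket (D i) (D (Suc j)) > 0"
        using pos[of i j] pos[of i "Suc j"] last ij
        by (cases "i < j"; cases "j = 3") (auto simp: numeral_eq_Suc)
      then have "s * bracket (D i) (D j) > 0 \<or> t * bracket (D i) (D (Suc j)) > 0" using st by auto
      moreover have "s * bracket (D i) (D j) \<ge> 0" "t * bracket (D i) (D (Suc j)) \<ge> 0"
        using st nonneg ij by simp_all
      ultimately show ?thesis unfolding vi st(3) bracket_simps by linarith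
    qed
  next
    case om: False
    then obtain s t where st: "s > 0" "t > 0" "v = s *\<^sub>R D i + t *\<^sub>R D (Suc i)"
      using v by (auto simp: in_sector_def i_def)
    have "i < j" using om m unfolding i_def j_def by presburger
    have p: "s * bracket (D i) (D j) > 0" "t * bracket (D (Suc i)) (D j) \<ge> 0"
      using st pos nonneg ij \<open>i < j\<close> by simp_all
    show ?thesis
    proof (cases "even m'")
      case True
      then have vj: "v' = D j" using v' by (simp add: in_sector_def j_def)
      show ?thesis unfolding st(3) vj bracket_simps using p by linarith
    next
      case False
      then obtain s' t' where st': "s' > 0" "t' > 0" "v' = s' *\<^sub>R D j + t' *\<^sub>R D (Suc j)"
        using v' by (auto simp: in_sector_def j_def)
      have "s * bracket (D i) (D (Suc j)) \<ge> 0" "t * bracket (D (Suc i)) (D (Suc j)) \<ge> 0"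
        using st nonneg ij by simp_all
      then have "s' * (s * bracket (D i) (D j) + t * bracket (D (Suc i)) (D j)) > 0"
        "t' * (s * bracket (D i) (D (Suc j)) + t * bracket (D (Suc i)) (D (Suc j))) \<ge> 0"
        using st' p by (simp_all add: add_pos_nonneg)
      then show ?thesis unfolding st(3) st'(3) bracket_simps by (simp add: algebra_simps)
    qed
  qed
qed

definition of_real_pair :: "real \<times> real \<Rightarrow> complex \<times> complex" where
  "of_real_pair v = (of_real (fst v), of_real (snd v))"

lemma bracket_of_real_pair: "bracket (of_real_pair u) (of_real_pair v) = of_real (bracket u v)"
  by (simp add: of_real_pair_def bracket_def)

text \<open>The place of \<open>t\<^sub>a\<^sub>b\<close> in the cyclic list of ends of rays: \<open>31, {41, 32}, 42, {12, 43}, 13, {23, 14}, 24,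
  {34, 21}\<close>, numbered from \<open>0\<close> to \<open>7\<close>. The point \<open>t\<^sub>a\<^sub>b\<close> lies near the vertex \<open>b\<close>, next to the end
  of the diagonal through \<open>b\<close>.\<close>

definition position :: "nat \<Rightarrow> nat \<Rightarrow> nat" where
  "position a b = (2 * b + (if b = a mod 4 + 1 then 7 else if a = b mod 4 + 1 then 5 else 6)) mod 8"

text \<open>The factors \<open>e a b\<close> are signs: homogeneous coordinates on the circle can only be ordered after
  replacing some of them by their negatives. Each vector occurs exactly once in every product of
  \<open>poly_det_cubics\<close>, so these signs change all products by the common factor \<open>E\<close>.\<close>

lemma AS_det_ge_1_if_cyclically_ordered:
  fixes e :: "nat \<Rightarrow> nat \<Rightarrow> real"
  assumes pair: "\<And>a b. a \<in> {1..4} \<Longrightarrow> b \<in> {1..4} \<Longrightarrow> a \<noteq> b \<Longrightarrow> p_pair x a b = linear_form (of_real_pair (w a b))"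
    and e: "\<And>a b. \<bar>e a b\<bar> = 1"
    and pos: "\<And>a b c d. a \<in> {1..4} \<Longrightarrow> b \<in> {1..4} \<Longrightarrow> a \<noteq> b \<Longrightarrow> c \<in> {1..4} \<Longrightarrow> d \<in> {1..4} \<Longrightarrow> c \<noteq> d \<Longrightarrow>
      position a b < position c d \<Longrightarrow> bracket (e a b *\<^sub>R w a b) (e c d *\<^sub>R w c d) > 0"
  shows "cmod (AS_det 4 x) \<ge> 1"
proof -
  define B where "B = (\<lambda>a b c d. bracket (e a b *\<^sub>R w a b) (e c d *\<^sub>R w c d))"
  define B0 where "B0 = (\<lambda>a b c d. bracket (w a b) (w c d))"
  have ee: "e a b * e a b = 1" for a b
    using e[of a b] by (metis abs_mult_self_eq mult_1)
  have B0: "B0 a b c d = e a b * e c d * B a b c d" for a b c d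
  proof -
    have "e a b * e c d * B a b c d = (e a b * e a b) * (e c d * e c d) * B0 a b c d"
      by (simp add: B_def B0_def bracket_simps)
    then show ?thesis by (simp add: ee)
  qed
  define E where "E = e 1 2 * e 1 3 * e 1 4 * e 2 1 * e 2 3 * e 2 4 * e 3 1 * e 3 2 * e 3 4 * e 4 1 * e 4 2 * e 4 3"
  define den where "den = B 3 1 1 3 * B 4 1 1 4 * B 3 2 2 3 * B 4 2 2 4 * B 1 2 2 1 * B 4 3 3 4"
  define rest where "rest = B 3 1 2 1 * B 4 1 2 3 * B 3 2 4 2 * B 1 2 3 4 * B 4 3 1 3 * B 1 4 2 4
     + B 3 1 4 1 * B 3 2 1 4 * B 4 2 1 2 * B 4 3 2 1 * B 1 3 2 3 * B 2 4 3 4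
     + B 3 1 4 1 * B 3 2 2 3 * B 4 2 2 1 * B 1 2 3 4 * B 4 3 1 3 * B 1 4 2 4
     + B 3 1 2 1 * B 4 1 2 3 * B 3 2 1 3 * B 4 2 1 2 * B 4 3 3 4 * B 1 4 2 4
     + B 3 1 2 1 * B 4 1 1 4 * B 3 2 4 2 * B 1 2 3 4 * B 4 3 2 4 * B 1 3 2 3
     + B 3 1 1 4 * B 4 1 2 3 * B 3 2 4 2 * B 1 2 2 1 * B 4 3 1 3 * B 2 4 3 4
     + B 3 1 4 1 * B 3 2 2 3 * B 4 2 1 2 * B 4 3 3 4 * B 1 3 2 1 * B 1 4 2 4
     + B 3 1 2 1 * B 4 1 1 4 * B 3 2 2 4 * B 4 2 1 2 * B 4 3 3 4 * B 1 3 2 3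
     + B 3 1 4 3 * B 4 1 1 4 * B 3 2 4 2 * B 1 2 2 1 * B 1 3 2 3 * B 2 4 3 4
     + B 3 1 4 1 * B 3 2 2 3 * B 4 2 1 4 * B 1 2 2 1 * B 4 3 1 3 * B 2 4 3 4"
  have P: "B a b c d > 0" if "position a b < position c d" "a \<in> {1..4}" "b \<in> {1..4}" "a \<noteq> b" "c \<in> {1..4}" "d \<in> {1..4}" "c \<noteq> d"
    for a b c d
    using pos that by (simp add: B_def)
  have den: "den > 0"
    unfolding den_def by (intro mult_pos_pos P) (simp_all add: position_def)
  have rest: "rest > 0"
    unfolding rest_def by (intro add_pos_pos mult_pos_pos P) (simp_all add: position_def)
  have list: "[1..<Suc 4] = [1, 2, 3, 4 :: nat]" by (simp add: numeral_eq_Suc)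
  have real: "B0 3 1 1 3 * B0 4 1 1 4 * B0 3 2 2 3 * B0 4 2 2 4 * B0 1 2 2 1 * B0 4 3 3 4
     + B0 3 1 2 1 * B0 4 1 2 3 * B0 3 2 4 2 * B0 1 2 3 4 * B0 4 3 1 3 * B0 1 4 2 4
     + B0 3 1 4 1 * B0 3 2 1 4 * B0 4 2 1 2 * B0 4 3 2 1 * B0 1 3 2 3 * B0 2 4 3 4
     + B0 3 1 4 1 * B0 3 2 2 3 * B0 4 2 2 1 * B0 1 2 3 4 * B0 4 3 1 3 * B0 1 4 2 4
     + B0 3 1 2 1 * B0 4 1 2 3 * B0 3 2 1 3 * B0 4 2 1 2 * B0 4 3 3 4 * B0 1 4 2 4
     + B0 3 1 2 1 * B0 4 1 1 4 * B0 3 2 4 2 * B0 1 2 3 4 * B0 4 3 2 4 * B0 1 3 2 3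
     + B0 3 1 1 4 * B0 4 1 2 3 * B0 3 2 4 2 * B0 1 2 2 1 * B0 4 3 1 3 * B0 2 4 3 4
     + B0 3 1 4 1 * B0 3 2 2 3 * B0 4 2 1 2 * B0 4 3 3 4 * B0 1 3 2 1 * B0 1 4 2 4
     + B0 3 1 2 1 * B0 4 1 1 4 * B0 3 2 2 4 * B0 4 2 1 2 * B0 4 3 3 4 * B0 1 3 2 3
     + B0 3 1 4 3 * B0 4 1 1 4 * B0 3 2 4 2 * B0 1 2 2 1 * B0 1 3 2 3 * B0 2 4 3 4
     + B0 3 1 4 1 * B0 3 2 2 3 * B0 4 2 1 4 * B0 1 2 2 1 * B0 4 3 1 3 * B0 2 4 3 4 = E * (den + rest)"
    unfolding B0 E_def den_def rest_def by (simp only: distrib_left mult_ac)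
  have "poly_det (map (p_point 4 x) [1..<Suc 4]) = of_real (- (E * (den + rest)))"
  proof -
    have c: "bracket (of_real_pair (w a b)) (of_real_pair (w c d)) = of_real (B0 a b c d)" for a b c d
      by (simp add: B0_def bracket_of_real_pair)
    have "poly_det (map (p_point 4 x) [1..<Suc 4]) = poly_det
      [linear_form (of_real_pair (w 1 2)) * linear_form (of_real_pair (w 1 3)) * linear_form (of_real_pair (w 1 4)),
       linear_form (of_real_pair (w 2 1)) * linear_form (of_real_pair (w 2 3)) * linear_form (of_real_pair (w 2 4)),
       linear_form (of_real_pair (w 3 1)) * linear_form (of_real_pair (w 3 2)) * linear_form (of_real_pair (w 3 4)),
       linear_form (of_real_pair (w 4 1)) * linear_form (of_real_pair (w 4 2)) * linear_form (of_real_pair (w 4 3))]"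
      unfolding list list.map p_point_4 using pair by simp
    then show ?thesis
      unfolding poly_det_cubics[of "\<lambda>a b. of_real_pair (w a b)"] c real[symmetric]
      by (simp only: of_real_mult of_real_add of_real_minus)
  qed
  moreover have "\<bar>E\<bar> = 1" by (simp add: E_def abs_mult e)
  ultimately have num: "cmod (poly_det (map (p_point 4 x) [1..<Suc 4])) = den + rest"
    using den rest by (simp only: norm_of_real abs_minus abs_mult) simp
  have two: "cmod (poly_det [p_pair x a b, p_pair x b a]) = \<bar>B a b b a\<bar>"
    if "a \<in> {1..4}" "b \<in> {1..4}" "a \<noteq> b" for a b
  proof -
    have "cmod (poly_det [p_pair x a b, p_pair x b a]) = \<bar>B0 a b b a\<bar>"
      using that pair by (simp add: poly_det_linear_forms bracket_of_real_pair B0_def)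
    then show ?thesis by (simp add: B0 abs_mult e)
  qed
  have B_commute: "\<bar>B a b c d\<bar> = \<bar>B c d a b\<bar>" for a b c d
    using bracket_commute[of "e a b *\<^sub>R w a b" "e c d *\<^sub>R w c d"] by (simp add: B_def)
  have "cmod (\<Prod>(a, b)\<in>{(a, b). 1 \<le> a \<and> a < b \<and> b \<le> 4}. poly_det [p_pair x a b, p_pair x b a]) = \<bar>den\<bar>"
    unfolding pairs_4 using B_commute[of 1 3 3 1] B_commute[of 1 4 4 1] B_commute[of 2 3 3 2]
      B_commute[of 2 4 4 2] B_commute[of 3 4 4 3]
    by (simp add: norm_mult two den_def abs_mult del: One_nat_def)
  then have "cmod (AS_det 4 x) = (den + rest) / den"
    using num den by (simp add: AS_det_def norm_divide)
  also have "\<dots> \<ge> 1" using den rest by simp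
  finally show ?thesis .
qed

section \<open>Rays between the ends of the diagonals\<close>

text \<open>Here the function \<open>O(u, v) = \<alpha> [u, b] [v, b] + \<alpha>' [u, b'] [v, b']\<close> is the form of a point inside the
  disc, and \<open>w\<close> represents a null vector of the shape \<open>\<rho> O + \<nu> a\<^sup>2 + \<nu>' b\<^sup>2\<close>. The form of a null
  vector has vanishing determinant, whereas for \<open>\<rho> \<ge> 0\<close> the sum would be positive definite. So \<open>\<rho> < 0\<close>,
  and the mixed value at \<open>a\<close> and \<open>b\<close>, to which only \<open>\<rho> O\<close> contributes, shows on which side of \<open>a\<close> and
  \<open>b\<close> the vector \<open>w\<close> lies.\<close>

lemma between_by_nullity:
  fixes a b b' w :: "real \<times> real"
  assumes eq: "\<And>u v. \<kappa> * (bracket u w * bracket v w) =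
      \<rho> * (\<alpha> * (bracket u b * bracket v b) + \<alpha>' * (bracket u b' * bracket v b'))
      + \<nu> * (bracket u a * bracket v a) + \<nu>' * (bracket u b * bracket v b)"
    and pos: "\<kappa> > 0" "\<alpha> > 0" "\<alpha>' > 0" "\<nu> > 0" "\<nu>' > 0"
    and ab: "bracket a b \<noteq> 0" and b': "bracket a b' * bracket b b' > 0"
  shows "bracket a w * bracket w b > 0"
proof -
  define O\<^sub>a\<^sub>a O\<^sub>b\<^sub>b O\<^sub>a\<^sub>b A where "O\<^sub>a\<^sub>a = \<alpha> * (bracket a b)\<^sup>2 + \<alpha>' * (bracket a b')\<^sup>2"
    and "O\<^sub>b\<^sub>b = \<alpha>' * (bracket b b')\<^sup>2" and "O\<^sub>a\<^sub>b = \<alpha>' * (bracket a b' * bracket b b')"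
    and "A = (bracket a b)\<^sup>2"
  have A: "A > 0" using ab by (simp add: A_def)
  have e: "\<kappa> * (bracket a w)\<^sup>2 = \<rho> * O\<^sub>a\<^sub>a + \<nu>' * A" "\<kappa> * (bracket b w)\<^sup>2 = \<rho> * O\<^sub>b\<^sub>b + \<nu> * A"
    "\<kappa> * (bracket a w * bracket b w) = \<rho> * O\<^sub>a\<^sub>b"
    using eq[of a a] eq[of b b] eq[of a b] bracket_commute[of b a]
    by (simp_all add: O\<^sub>a\<^sub>a_def O\<^sub>b\<^sub>b_def O\<^sub>a\<^sub>b_def A_def bracket_simps power2_eq_square)
  have "O\<^sub>a\<^sub>b > 0" using pos b' by (simp add: O\<^sub>a\<^sub>b_def)
  have CS: "O\<^sub>a\<^sub>b\<^sup>2 \<le> O\<^sub>a\<^sub>a * O\<^sub>b\<^sub>b"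
  proof -
    have "O\<^sub>a\<^sub>a * O\<^sub>b\<^sub>b = O\<^sub>a\<^sub>b\<^sup>2 + \<alpha> * \<alpha>' * (bracket a b * bracket b b')\<^sup>2"
      by (simp add: O\<^sub>a\<^sub>a_def O\<^sub>b\<^sub>b_def O\<^sub>a\<^sub>b_def power2_eq_square algebra_simps)
    then show ?thesis using pos by simp
  qed
  have "\<rho> < 0"
  proof (rule ccontr)
    assume "\<not> \<rho> < 0"
    then have r: "\<rho> \<ge> 0" by simp
    have "O\<^sub>a\<^sub>a \<ge> 0" "O\<^sub>b\<^sub>b \<ge> 0" using pos by (simp_all add: O\<^sub>a\<^sub>a_def O\<^sub>b\<^sub>b_def)
    have "(\<rho> * O\<^sub>a\<^sub>b)\<^sup>2 \<le> (\<rho> * O\<^sub>a\<^sub>a) * (\<rho> * O\<^sub>b\<^sub>b)"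
      using mult_left_mono[OF CS, of "\<rho>\<^sup>2"] by (simp add: power_mult_distrib power2_eq_square mult_ac)
    also have "\<dots> < (\<rho> * O\<^sub>a\<^sub>a + \<nu>' * A) * (\<rho> * O\<^sub>b\<^sub>b + \<nu> * A)"
    proof -
      have "\<rho> * O\<^sub>a\<^sub>a * (\<nu> * A) \<ge> 0" "\<nu>' * A * (\<rho> * O\<^sub>b\<^sub>b) \<ge> 0" "\<nu>' * A * (\<nu> * A) > 0"
        using r A pos \<open>O\<^sub>a\<^sub>a \<ge> 0\<close> \<open>O\<^sub>b\<^sub>b \<ge> 0\<close> by simp_all
      then show ?thesis by (simp add: algebra_simps)
    qed
    also have "\<dots> = (\<rho> * O\<^sub>a\<^sub>b)\<^sup>2"
      unfolding e[symmetric] by (simp add: power2_eq_square)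
    finally show False by simp
  qed
  then have "\<kappa> * (bracket a w * bracket b w) < 0"
    using e(3) \<open>O\<^sub>a\<^sub>b > 0\<close> by (simp add: mult_neg_pos)
  then have "bracket a w * bracket b w < 0" using pos by (simp add: mult_less_0_iff)
  then show ?thesis by (simp add: bracket_commute[of w b])
qed

lemma sector_up_to_sign:
  fixes a b w :: "real \<times> real"
  assumes "bracket a b > 0" "bracket a w * bracket w b > 0"
  obtains e s t where "\<bar>e\<bar> = 1" "s > 0" "t > 0" "e *\<^sub>R w = s *\<^sub>R a + t *\<^sub>R b"
proof -
  define e where "e = sgn (bracket a w)"
  have "bracket a w \<noteq> 0" using assms(2) by auto
  then have e: "\<bar>e\<bar> = 1" "e * bracket a w > 0" "e * bracket w b > 0"
    using assms(2) by (auto simp: e_def sgn_if zero_less_mult_iff)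
  have "e *\<^sub>R w = (e / bracket a b) *\<^sub>R (bracket a b *\<^sub>R w)" using assms(1) by simp
  also have "\<dots> = (e * bracket w b / bracket a b) *\<^sub>R a + (e * bracket a w / bracket a b) *\<^sub>R b"
    unfolding bracket_decompose[of a b w] by (simp add: scaleR_add_right)
  finally show thesis using e assms(1) by (intro that[of e]) auto
qed

text \<open>The points \<open>X\<close> and \<open>Y\<close> are the ends of a diagonal, \<open>Z\<close> is a point between them, and \<open>d\<close> and \<open>d'\<close> are
  the ends of the line on the sides of \<open>X\<close> and \<open>Y\<close>. Seen modulo \<open>Z\<close>, the point
  \<open>X\<close> is directed towards \<open>d\<close> and away from \<open>d'\<close>, and \<open>Z\<close> lies between \<open>d\<close> and \<open>d'\<close>.\<close>

lemma diagonal_decomposition: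
  fixes X Y Z :: "real \<times> real \<Rightarrow> real \<times> real \<Rightarrow> real"
  assumes X: "\<And>u v. X u v - k * Y u v = \<kappa> * (bracket u d * bracket v d)"
    and Y: "\<And>u v. Y u v - k * X u v = \<kappa>' * (bracket u d' * bracket v d')"
    and Z: "\<And>u v. Z u v = c * X u v + c' * Y u v"
    and pos: "0 < k" "k < 1" "\<kappa> > 0" "\<kappa>' > 0" "c > 0" "c' > 0"
  shows "\<exists>\<rho> \<nu>. \<nu> > 0 \<and> (\<forall>u v. X u v = \<rho> * Z u v + \<nu> * (bracket u d * bracket v d))"
    and "\<exists>\<rho> \<nu>. \<nu> > 0 \<and> (\<forall>u v. X u v = \<rho> * Z u v - \<nu> * (bracket u d' * bracket v d'))"
    and "\<exists>\<alpha> \<alpha>'. \<alpha> > 0 \<and> \<alpha>' > 0 \<and>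
      (\<forall>u v. Z u v = \<alpha> * (bracket u d * bracket v d) + \<alpha>' * (bracket u d' * bracket v d'))"
proof -
  have q: "k * c + c' > 0" "c + k * c' > 0" "1 - k * k > 0"
    using pos mult_strict_mono[of k 1 k 1] by (simp_all add: add_pos_pos)
  have "X u v = k / (k * c + c') * Z u v + c' * \<kappa> / (k * c + c') * (bracket u d * bracket v d)" for u v
  proof -
    have eq: "(k * c + c') * X u v = k * Z u v + c' * (\<kappa> * (bracket u d * bracket v d))"
      unfolding Z X[symmetric] by (simp add: algebra_simps)
    have "X u v = (1 / (k * c + c')) * ((k * c + c') * X u v)" using q by simp
    then show ?thesis unfolding eq by (simp add: add_divide_distrib diff_divide_distrib)
  qed
  then show "\<exists>\<rho> \<nu>. \<nu> > 0 \<and> (\<forall>u v. X u v = \<rho> * Z u v + \<nu> * (bracket u d * bracket v d))"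
    using pos q by (intro exI[of _ "k / (k * c + c')"] exI[of _ "c' * \<kappa> / (k * c + c')"]) auto
  have "X u v = 1 / (c + k * c') * Z u v - c' * \<kappa>' / (c + k * c') * (bracket u d' * bracket v d')" for u v
  proof -
    have eq: "(c + k * c') * X u v = Z u v - c' * (\<kappa>' * (bracket u d' * bracket v d'))"
      unfolding Z Y[symmetric] by (simp add: algebra_simps)
    have "X u v = (1 / (c + k * c')) * ((c + k * c') * X u v)" using q by simp
    then show ?thesis unfolding eq by (simp add: add_divide_distrib diff_divide_distrib)
  qed
  then show "\<exists>\<rho> \<nu>. \<nu> > 0 \<and> (\<forall>u v. X u v = \<rho> * Z u v - \<nu> * (bracket u d' * bracket v d'))"
    using pos q by (intro exI[of _ "1 / (c + k * c')"] exI[of _ "c' * \<kappa>' / (c + k * c')"]) auto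
  have "Z u v = (c + k * c') * \<kappa> / (1 - k * k) * (bracket u d * bracket v d)
      + (k * c + c') * \<kappa>' / (1 - k * k) * (bracket u d' * bracket v d')" for u v
  proof -
    have divide: "x = A / m * s + B / m * t" if "m > 0" "m * x = A * s + B * t" for m x A B s t :: real
      using that by (simp add: field_simps)
    show ?thesis
    proof (rule divide[OF q(3)])
      show "(1 - k * k) * Z u v = (c + k * c') * \<kappa> * (bracket u d * bracket v d)
          + (k * c + c') * \<kappa>' * (bracket u d' * bracket v d')"
        unfolding mult.assoc Z X[symmetric] Y[symmetric] by (simp add: algebra_simps)
    qed
  qed
  then show "\<exists>\<alpha> \<alpha>'. \<alpha> > 0 \<and> \<alpha>' > 0 \<and>
      (\<forall>u v. Z u v = \<alpha> * (bracket u d * bracket v d) + \<alpha>' * (bracket u d' * bracket v d'))"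
    using pos q by (intro exI[of _ "(c + k * c') * \<kappa> / (1 - k * k)"] exI[of _ "(k * c + c') * \<kappa>' / (1 - k * k)"]) auto
qed

text \<open>The ray from a vertex \<open>Y\<close> on one diagonal through a vertex \<open>X\<close> on the other, seen modulo \<open>Z\<close>: it moves
  towards the end \<open>d\<close> behind \<open>X\<close> and towards the end \<open>d'\<close> opposite to \<open>Y\<close>.\<close>

lemma opposite_rays_combination:
  fixes X Y Z :: "real \<times> real \<Rightarrow> real \<times> real \<Rightarrow> real"
  assumes "\<exists>\<rho> \<nu>. \<nu> > 0 \<and> (\<forall>u v. X u v = \<rho> * Z u v + \<nu> * (bracket u d * bracket v d))"
    and "\<exists>\<rho> \<nu>. \<nu> > 0 \<and> (\<forall>u v. Y u v = \<rho> * Z u v - \<nu> * (bracket u d' * bracket v d'))"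
    and "k > 0" "\<And>u v. X u v - k * Y u v = \<kappa> * (bracket u w * bracket v w)"
  shows "\<exists>\<rho> \<nu> \<nu>'. \<nu> > 0 \<and> \<nu>' > 0 \<and> (\<forall>u v. \<kappa> * (bracket u w * bracket v w) =
    \<rho> * Z u v + \<nu> * (bracket u d * bracket v d) + \<nu>' * (bracket u d' * bracket v d'))"
proof -
  obtain \<rho> \<nu> where X: "\<nu> > 0" "\<And>u v. X u v = \<rho> * Z u v + \<nu> * (bracket u d * bracket v d)"
    using assms(1) by blast
  obtain \<rho>' \<nu>' where Y: "\<nu>' > 0" "\<And>u v. Y u v = \<rho>' * Z u v - \<nu>' * (bracket u d' * bracket v d')"
    using assms(2) by blast
  have "\<kappa> * (bracket u w * bracket v w) = (\<rho> - k * \<rho>') * Z u v + \<nu> * (bracket u d * bracket v d)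
      + k * \<nu>' * (bracket u d' * bracket v d')" for u v
    unfolding assms(4)[symmetric] X(2) Y(2) by (simp add: algebra_simps)
  then show ?thesis using X(1) Y(1) assms(3)
    by (intro exI[of _ "\<rho> - k * \<rho>'"] exI[of _ \<nu>] exI[of _ "k * \<nu>'"]) auto
qed


text \<open>The hypotheses \<open>ray\<close>, \<open>Z13\<close> and \<open>Z24\<close> say that the \<open>w a b\<close> are the ends of the rays and that \<open>Z\<close> is the
  crossing point of the diagonals. The hypothesis \<open>orient\<close> contains each of its three vectors twice and
  is thus independent of their signs. It fixes the direction in which the vertices are numbered.\<close>

lemma quadrilateral_sectors:
  fixes X :: "nat \<Rightarrow> real \<times> real \<Rightarrow> real \<times> real \<Rightarrow> real"
    and Z :: "real \<times> real \<Rightarrow> real \<times> real \<Rightarrow> real" and c :: "nat \<Rightarrow> real" and k \<kappa> :: "nat \<Rightarrow> nat \<Rightarrow> real"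
  assumes ray: "\<And>a b u v. a \<in> {1..4} \<Longrightarrow> b \<in> {1..4} \<Longrightarrow> a \<noteq> b \<Longrightarrow>
      X b u v - k a b * X a u v = \<kappa> a b * (bracket u (w a b) * bracket v (w a b))"
    and k: "\<And>a b. a \<in> {1..4} \<Longrightarrow> b \<in> {1..4} \<Longrightarrow> a \<noteq> b \<Longrightarrow> 0 < k a b \<and> k a b < 1 \<and> \<kappa> a b > 0"
    and k_commute: "\<And>a b. k a b = k b a"
    and Z13: "\<And>u v. Z u v = c 1 * X 1 u v + c 3 * X 3 u v"
    and Z24: "\<And>u v. Z u v = c 2 * X 2 u v + c 4 * X 4 u v"
    and c: "\<And>a. a \<in> {1..4} \<Longrightarrow> c a > 0"
    and orient: "bracket (w 3 1) (w 4 2) * bracket (w 4 2) (w 1 3) * bracket (w 3 1) (w 1 3) > 0"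
  obtains D e where "\<And>a b. \<bar>e a b\<bar> = (1 :: real)"
    and "\<And>i j. i \<le> j \<Longrightarrow> j \<le> 4 \<Longrightarrow> bracket (D i) (D j) \<ge> 0"
    and "\<And>i j. i < j \<Longrightarrow> j \<le> 3 \<Longrightarrow> bracket (D i) (D j) > 0" "bracket (D 3) (D 4) > 0"
    and "\<And>a b. a \<in> {1..4} \<Longrightarrow> b \<in> {1..4} \<Longrightarrow> a \<noteq> b \<Longrightarrow> in_sector D (position a b) (e a b *\<^sub>R w a b)"
proof -
  let ?sq = "\<lambda>d u v. bracket u d * bracket v d"
  have c4: "c 1 > 0" "c 2 > 0" "c 3 > 0" "c 4 > 0" using c by auto
  have r13: "\<And>u v. X 1 u v - k 1 3 * X 3 u v = \<kappa> 3 1 * ?sq (w 3 1) u v" "\<And>u v. X 3 u v - k 1 3 * X 1 u v = \<kappa> 1 3 * ?sq (w 1 3) u v"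
    using ray[of 3 1] ray[of 1 3] k_commute[of 3 1] by auto
  have r24: "\<And>u v. X 2 u v - k 2 4 * X 4 u v = \<kappa> 4 2 * ?sq (w 4 2) u v" "\<And>u v. X 4 u v - k 2 4 * X 2 u v = \<kappa> 2 4 * ?sq (w 2 4) u v"
    using ray[of 4 2] ray[of 2 4] k_commute[of 4 2] by auto
  have Z31: "Z u v = c 3 * X 3 u v + c 1 * X 1 u v" and Z42: "Z u v = c 4 * X 4 u v + c 2 * X 2 u v" for u v
    using Z13[of u v] Z24[of u v] by simp_all
  have kk: "0 < k 1 3" "k 1 3 < 1" "0 < k 2 4" "k 2 4 < 1" "\<kappa> 1 3 > 0" "\<kappa> 3 1 > 0" "\<kappa> 2 4 > 0" "\<kappa> 4 2 > 0"
    using k[of 1 3] k[of 3 1] k[of 2 4] k[of 4 2] by auto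
  note v1 = diagonal_decomposition[OF r13 Z13 kk(1,2,6,5) c4(1,3)]
  note v3 = diagonal_decomposition[OF r13(2,1) Z31 kk(1,2,5,6) c4(3,1)]
  note v2 = diagonal_decomposition[OF r24 Z24 kk(3,4,8,7) c4(2,4)]
  note v4 = diagonal_decomposition[OF r24(2,1) Z42 kk(3,4,7,8) c4(4,2)]
  obtain \<alpha>1 \<alpha>3 where \<alpha>: "\<alpha>1 > 0" "\<alpha>3 > 0" "\<And>u v. Z u v = \<alpha>1 * ?sq (w 3 1) u v + \<alpha>3 * ?sq (w 1 3) u v"
    using v1(3) by blast
  obtain \<alpha>2 \<alpha>4 where \<beta>: "\<alpha>2 > 0" "\<alpha>4 > 0" "\<And>u v. Z u v = \<alpha>2 * ?sq (w 4 2) u v + \<alpha>4 * ?sq (w 2 4) u v"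
    using v2(3) by blast
  \<comment> \<open>Evaluating \<open>Z\<close> at both ends of the diagonal \<open>13\<close> kills the first expression for \<open>Z\<close>, so the ends of
    the diagonal \<open>24\<close> lie on different sides of the diagonal \<open>13\<close>.\<close>
  have "\<alpha>4 * (bracket (w 3 1) (w 2 4) * bracket (w 1 3) (w 2 4)) =
      \<alpha>2 * (bracket (w 3 1) (w 4 2) * bracket (w 4 2) (w 1 3))"
    using \<alpha>(3)[of "w 3 1" "w 1 3"] \<beta>(3)[of "w 3 1" "w 1 3"] bracket_commute[of "w 1 3" "w 4 2"]
    by (simp add: bracket_simps(7))
  then have "\<alpha>4 * (bracket (w 3 1) (w 2 4) * bracket (w 1 3) (w 2 4) * bracket (w 3 1) (w 1 3)) =
      \<alpha>2 * (bracket (w 3 1) (w 4 2) * bracket (w 4 2) (w 1 3) * bracket (w 3 1) (w 1 3))"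
    by (simp only: mult.assoc[symmetric])
  also have "\<dots> > 0" using orient \<beta> by simp
  finally have orient': "bracket (w 3 1) (w 2 4) * bracket (w 1 3) (w 2 4) * bracket (w 3 1) (w 1 3) > 0"
    using \<beta> by (simp add: zero_less_mult_iff)
  define e13 e42 e24 where "e13 = sgn (bracket (w 3 1) (w 1 3))" and "e42 = sgn (bracket (w 3 1) (w 4 2))"
    and "e24 = sgn (bracket (w 3 1) (w 2 4))"
  have nz: "bracket (w 3 1) (w 1 3) \<noteq> 0" "bracket (w 3 1) (w 4 2) \<noteq> 0" "bracket (w 3 1) (w 2 4) \<noteq> 0"
    using orient orient' by auto
  have ee: "\<bar>e13\<bar> = 1" "\<bar>e42\<bar> = 1" "\<bar>e24\<bar> = 1" "e13 * e13 = 1" "e42 * e42 = 1" "e24 * e24 = 1"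
    using nz by (auto simp: e13_def e42_def e24_def sgn_if)
  define D where "D i = (if i = 0 then w 3 1 else if i = 1 then e42 *\<^sub>R w 4 2 else if i = 2 then e13 *\<^sub>R w 1 3
    else if i = 3 then e24 *\<^sub>R w 2 4 else - w 3 1)" for i :: nat
  have D: "D 0 = w 3 1" "D 1 = e42 *\<^sub>R w 4 2" "D 2 = e13 *\<^sub>R w 1 3" "D 3 = e24 *\<^sub>R w 2 4" "D 4 = - w 3 1"
    "D (Suc 0) = e42 *\<^sub>R w 4 2"
    by (simp_all add: D_def)
  have b0: "bracket (D 0) (D 1) > 0" "bracket (D 0) (D 2) > 0" "bracket (D 0) (D 3) > 0"
    using nz by (auto simp: D bracket_simps e13_def e42_def e24_def sgn_if)
  have "bracket (D 0) (D 1) * bracket (D 1) (D 2) * bracket (D 0) (D 2) =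
      (e42 * e42) * (e13 * e13) * (bracket (w 3 1) (w 4 2) * bracket (w 4 2) (w 1 3) * bracket (w 3 1) (w 1 3))"
    by (simp add: D bracket_simps)
  then have "bracket (D 0) (D 1) * bracket (D 1) (D 2) * bracket (D 0) (D 2) > 0"
    using orient by (simp add: ee)
  then have b12: "bracket (D 1) (D 2) > 0"
    using b0 by (simp add: zero_less_mult_iff)
  have "bracket (D 0) (D 3) * bracket (D 2) (D 3) * bracket (D 0) (D 2) =
      (e24 * e24) * (e13 * e13) * (bracket (w 3 1) (w 2 4) * bracket (w 1 3) (w 2 4) * bracket (w 3 1) (w 1 3))"
    by (simp add: D bracket_simps)
  then have "bracket (D 0) (D 3) * bracket (D 2) (D 3) * bracket (D 0) (D 2) > 0"
    using orient' by (simp add: ee)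
  then have b23: "bracket (D 2) (D 3) > 0"
    using b0 by (simp add: zero_less_mult_iff)
  \<comment> \<open>the Pluecker relation\<close>
  have "bracket (D 0) (D 2) * bracket (D 1) (D 3) = bracket (D 0) (D 1) * bracket (D 2) (D 3) + bracket (D 0) (D 3) * bracket (D 1) (D 2)"
    by (simp add: bracket_def algebra_simps)
  also have "\<dots> > 0" using b0 b12 b23 by (simp add: add_pos_pos)
  finally have b13: "bracket (D 1) (D 3) > 0" using b0 by (simp add: zero_less_mult_iff)
  have D4: "D 4 = - D 0" by (simp add: D)
  have b4: "bracket (D 0) (D 4) = 0" "bracket (D 1) (D 4) > 0" "bracket (D 2) (D 4) > 0" "bracket (D 3) (D 4) > 0"
    using b0 bracket_commute[of "D 0" "D 1"] bracket_commute[of "D 0" "D 2"] bracket_commute[of "D 0" "D 3"]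
    by (simp_all add: D4 bracket_simps)
  note bs = b0 b12 b23 b13 b4
  have pos: "bracket (D i) (D j) > 0" if "i < j" "j \<le> 3" for i j
  proof -
    have "(i = 0 \<and> j = 1) \<or> (i = 0 \<and> j = 2) \<or> (i = 0 \<and> j = 3) \<or> (i = 1 \<and> j = 2) \<or> (i = 1 \<and> j = 3) \<or> (i = 2 \<and> j = 3)"
      using that by linarith
    then show ?thesis using bs by auto
  qed
  have nonneg: "bracket (D i) (D j) \<ge> 0" if "i \<le> j" "j \<le> 4" for i j
  proof -
    have "i = j \<or> (i < j \<and> j \<le> 3) \<or> (j = 4 \<and> (i = 0 \<or> i = 1 \<or> i = 2 \<or> i = 3))"
      using that by linarith
    then show ?thesis using pos[of i j] bs by (auto simp: bracket_simps)
  qed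
  have sqD: "?sq (D 0) u v = ?sq (w 3 1) u v" "?sq (D 1) u v = ?sq (w 4 2) u v" "?sq (D 2) u v = ?sq (w 1 3) u v"
    "?sq (D 3) u v = ?sq (w 2 4) u v" "?sq (D 4) u v = ?sq (w 3 1) u v"
    "?sq (D (Suc 0)) u v = ?sq (w 4 2) u v" for u v
    using ee by (simp_all add: D bracket_simps)
  \<comment> \<open>The ends of one diagonal have indices that differ by \<open>2\<close>. Hence \<open>D ((m + 3) mod 4)\<close> is, up to sign, the end
    opposite to \<open>D (m + 1)\<close>.\<close>
  have Zb: "\<exists>\<alpha> \<alpha>'. \<alpha> > 0 \<and> \<alpha>' > 0 \<and> (\<forall>u v. Z u v = \<alpha> * ?sq (D (Suc m)) u v + \<alpha>' * ?sq (D ((m + 3) mod 4)) u v)"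
    if "m < 4" for m
  proof -
    have "m = 0 \<or> m = 1 \<or> m = 2 \<or> m = 3" using that by linarith
    then show ?thesis
    proof (elim disjE)
      assume "m = 0" then show ?thesis using v2(3) by (simp add: sqD)
    next
      assume "m = 1" then show ?thesis using v3(3) by (simp add: sqD flip: numeral_2_eq_2)
    next
      assume "m = 2" then show ?thesis using v4(3) by (simp add: sqD)
    next
      assume "m = 3" then show ?thesis using v1(3) by (simp add: sqD)
    qed
  qed
  have b': "bracket (D m) (D ((m + 3) mod 4)) * bracket (D (Suc m)) (D ((m + 3) mod 4)) > 0" if "m < 4" for m
  proof -
    have neg: "bracket (D j) (D i) < 0" if "bracket (D i) (D j) > 0" for i j
      using that bracket_commute[of "D i" "D j"] by simp
    have "m = 0 \<or> m = 1 \<or> m = 2 \<or> m = 3" using that by linarith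
    then show ?thesis
    proof (elim disjE)
      assume "m = 0" then show ?thesis using bs by simp
    next
      assume "m = 1" then show ?thesis
        using neg[OF bs(1)] neg[OF bs(2)] by (simp add: mult_neg_neg numeral_2_eq_2[symmetric])
    next
      assume "m = 2" then show ?thesis
        using neg[OF bs(4)] neg[OF bs(6)] by (simp add: mult_neg_neg)
    next
      assume "m = 3" then show ?thesis
        using neg[OF bs(5)] neg[OF bs(9)] by (simp add: mult_neg_neg)
    qed
  qed
  have side: "\<exists>e. \<bar>e\<bar> = 1 \<and> in_sector D (2 * m + 1) (e *\<^sub>R w')"
    if m: "m < 4" and "\<kappa>' > 0"
      and comb: "\<exists>\<rho> \<nu> \<nu>'. \<nu> > 0 \<and> \<nu>' > 0 \<and> (\<forall>u v. \<kappa>' * ?sq w' u v =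
        \<rho> * Z u v + \<nu> * ?sq (D m) u v + \<nu>' * ?sq (D (Suc m)) u v)" for m w' \<kappa>'
  proof -
    obtain \<rho> \<nu> \<nu>' where 1: "\<nu> > 0" "\<nu>' > 0" "\<And>u v. \<kappa>' * ?sq w' u v =
        \<rho> * Z u v + \<nu> * ?sq (D m) u v + \<nu>' * ?sq (D (Suc m)) u v"
      using comb by blast
    obtain \<alpha> \<alpha>' where 2: "\<alpha> > 0" "\<alpha>' > 0"
      "\<And>u v. Z u v = \<alpha> * ?sq (D (Suc m)) u v + \<alpha>' * ?sq (D ((m + 3) mod 4)) u v"
      using Zb[OF m] by blast
    have 3: "bracket (D m) (D (Suc m)) > 0"
      using m pos[of m "Suc m"] b4(4) by (cases "m = 3") (auto simp: numeral_eq_Suc)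
    have "bracket (D m) w' * bracket w' (D (Suc m)) > 0"
      using between_by_nullity[OF 1(3)[unfolded 2(3)] \<open>\<kappa>' > 0\<close> 2(1,2) 1(1,2) _ b'[OF m]] 3 by simp
    then obtain e s t where "\<bar>e\<bar> = 1" "s > 0" "t > 0" "e *\<^sub>R w' = s *\<^sub>R D m + t *\<^sub>R D (Suc m)"
      using sector_up_to_sign[OF 3] by blast
    then show ?thesis by (intro exI[of _ e]) (auto simp: in_sector_def)
  qed
  have comb: "\<exists>\<rho> \<nu> \<nu>'. \<nu> > 0 \<and> \<nu>' > 0 \<and> (\<forall>u v. \<kappa>' * ?sq w' u v = \<rho> * Z u v + \<nu> * ?sq d u v + \<nu>' * ?sq d' u v)"
    if h: "\<exists>\<rho> \<nu> \<nu>'. \<nu> > 0 \<and> \<nu>' > 0 \<and> (\<forall>u v. \<kappa>' * ?sq w' u v = \<rho> * Z u v + \<nu> * ?sq d' u v + \<nu>' * ?sq d u v)"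
    for \<kappa>' w' d d'
  proof -
    obtain \<rho> \<nu> \<nu>' where "\<nu> > 0" "\<nu>' > 0" "\<And>u v. \<kappa>' * ?sq w' u v = \<rho> * Z u v + \<nu> * ?sq d' u v + \<nu>' * ?sq d u v"
      using h by blast
    then show ?thesis by (intro exI[of _ \<rho>] exI[of _ \<nu>'] exI[of _ \<nu>]) (auto simp: algebra_simps)
  qed
  have ex: "\<exists>e. \<bar>e\<bar> = 1 \<and> in_sector D (position a b) (e *\<^sub>R w a b)"
    if "a \<in> {1..4}" "b \<in> {1..4}" "a \<noteq> b" for a b
  proof -
    note ab = that and kab = k[OF that] and R = opposite_rays_combination[OF _ _ _ ray[OF that]]
    have "a = 1 \<or> a = 2 \<or> a = 3 \<or> a = 4" "b = 1 \<or> b = 2 \<or> b = 3 \<or> b = 4" using that by auto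
    then consider "a = 3" "b = 1" | "a = 4" "b = 2" | "a = 1" "b = 3" | "a = 2" "b = 4"
      | "a = 4" "b = 1" | "a = 3" "b = 2" | "a = 1" "b = 2" | "a = 4" "b = 3"
      | "a = 2" "b = 3" | "a = 1" "b = 4" | "a = 3" "b = 4" | "a = 2" "b = 1"
      using ab by auto
    then show ?thesis
    proof cases
      case 1 then show ?thesis by (intro exI[of _ 1]) (simp add: position_def in_sector_def D)
    next
      case 2 then show ?thesis using ee by (intro exI[of _ e42]) (simp add: position_def in_sector_def D)
    next
      case 3 then show ?thesis using ee by (intro exI[of _ e13]) (simp add: position_def in_sector_def D)
    next
      case 4 then show ?thesis using ee by (intro exI[of _ e24]) (simp add: position_def in_sector_def D)
    next
      case 5
      show ?thesis using side[of 0 "\<kappa> a b" "w a b"] R[OF v1(1)[folded 5] v4(2)[folded 5]] kab 5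
        by (simp add: position_def sqD)
    next
      case 6
      show ?thesis using side[of 0 "\<kappa> a b" "w a b"] comb[OF R[OF v2(1)[folded 6] v3(2)[folded 6]]] kab 6
        by (simp add: position_def sqD)
    next
      case 7
      show ?thesis using side[of 1 "\<kappa> a b" "w a b"] R[OF v2(1)[folded 7] v1(2)[folded 7]] kab 7
        by (simp add: position_def sqD flip: numeral_2_eq_2)
    next
      case 8
      show ?thesis using side[of 1 "\<kappa> a b" "w a b"] comb[OF R[OF v3(1)[folded 8] v4(2)[folded 8]]] kab 8
        by (simp add: position_def sqD flip: numeral_2_eq_2)
    next
      case 9
      show ?thesis using side[of 2 "\<kappa> a b" "w a b"] R[OF v3(1)[folded 9] v2(2)[folded 9]] kab 9
        by (simp add: position_def sqD)
    next
      case 10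
      show ?thesis using side[of 2 "\<kappa> a b" "w a b"] comb[OF R[OF v4(1)[folded 10] v1(2)[folded 10]]] kab 10
        by (simp add: position_def sqD)
    next
      case 11
      show ?thesis using side[of 3 "\<kappa> a b" "w a b"] R[OF v4(1)[folded 11] v3(2)[folded 11]] kab 11
        by (simp add: position_def sqD)
    next
      case 12
      show ?thesis using side[of 3 "\<kappa> a b" "w a b"] comb[OF R[OF v1(1)[folded 12] v2(2)[folded 12]]] kab 12
        by (simp add: position_def sqD)
    qed
  qed
  then have "\<forall>p. \<exists>e. \<bar>e\<bar> = 1 \<and> (fst p \<in> {1..4} \<and> snd p \<in> {1..4} \<and> fst p \<noteq> snd p \<longrightarrow>
      in_sector D (position (fst p) (snd p)) (e *\<^sub>R w (fst p) (snd p)))"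
    by (metis abs_1)
  then obtain f where f: "\<And>p. \<bar>f p\<bar> = (1 :: real)"
    "\<And>p. fst p \<in> {1..4} \<and> snd p \<in> {1..4} \<and> fst p \<noteq> snd p \<longrightarrow>
      in_sector D (position (fst p) (snd p)) (f p *\<^sub>R w (fst p) (snd p))"
    by metis
  show thesis
    using that[of "\<lambda>a b. f (a, b)" D] f(1) f(2) nonneg pos b4(4) by force
qed

section \<open>Ends of rays in homogeneous coordinates\<close>

text \<open>Homogeneous coordinates of the end of a ray, scaled so that \<open>p_pair\<close> is exactly the associated linear
  form: the constant polynomial \<open>1\<close>, which stands for the point at infinity, belongs to \<open>(-1, 0)\<close>.\<close>

definition spinor :: "(nat \<Rightarrow> real ^ 3) \<Rightarrow> nat \<Rightarrow> nat \<Rightarrow> real \<times> real" where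
  "spinor x a b = (case t_end x a b of None \<Rightarrow> (-1, 0) | Some \<tau> \<Rightarrow> (Re \<tau>, 1))"

text \<open>The polar form of a binary quadratic form whose determinant is the Lorentzian square of \<open>X\<close>, for
  \<open>X\<close> in the plane of \<open>H2\<close>. Null vectors become squares of linear forms, and the root of such a form
  is the stereographic image of the boundary point.\<close>

definition qform :: "spacetime \<Rightarrow> real \<times> real \<Rightarrow> real \<times> real \<Rightarrow> real" where
  "qform X u v = fst u * fst v * (fst X - snd X $ 3)
     - (fst u * snd v + snd u * fst v) * snd X $ 1 + snd u * snd v * (fst X + snd X $ 3)"

lemma qform_linear:
  "qform (X + Y) u v = qform X u v + qform Y u v" "qform (X - Y) u v = qform X u v - qform Y u v"
  "qform (c *\<^sub>R X) u v = c * qform X u v"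
  by (simp_all add: qform_def algebra_simps)

lemma qform_eq_imp_eq:
  assumes "snd X $ 2 = 0" "snd Y $ 2 = 0" "\<And>u v. qform X u v = qform Y u v"
  shows "X = Y"
proof -
  have "fst X - snd X $ 3 = fst Y - snd Y $ 3" "snd X $ 1 = snd Y $ 1" "fst X + snd X $ 3 = fst Y + snd Y $ 3"
    using assms(3)[of "(1, 0)" "(1, 0)"] assms(3)[of "(1, 0)" "(0, 1)"] assms(3)[of "(0, 1)" "(0, 1)"]
    by (simp_all add: qform_def)
  then have "fst X = fst Y" "snd X $ 1 = snd Y $ 1" "snd X $ 3 = snd Y $ 3" by linarith+
  then show ?thesis using assms(1,2) by (simp add: prod_eq_iff Finite_Cartesian_Product.vec_eq_iff forall_3)
qed

lemma inner_plane:
  fixes r s :: "real ^ 3" assumes "r $ 2 = 0" shows "r \<bullet> s = r $ 1 * s $ 1 + r $ 3 * s $ 3"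
  using assms by (simp add: inner_vec_def sum_3)

lemma qform_pos:
  assumes X: "X \<in> hyperboloid" "snd X $ 2 = 0" and u: "u \<noteq> (0, 0)"
  shows "qform X u u > 0"
proof -
  obtain p q where pq: "u = (p, q)" by (cases u)
  define A B C where "A = fst X - snd X $ 3" and "B = snd X $ 1" and "C = fst X + snd X $ 3"
  have "A * C - B\<^sup>2 = 1" "A + C > 0"
    using X by (auto simp: hyperboloid_def mink_def inner_plane A_def B_def C_def power2_eq_square algebra_simps)
  then have AC: "A * C = 1 + B\<^sup>2" by simp
  then have "A * C > 0" by (simp add: add_pos_nonneg)
  then have A: "A > 0" using \<open>A + C > 0\<close> by (auto simp: zero_less_mult_iff)
  have "A * qform X u u = (A * p - B * q)\<^sup>2 + q\<^sup>2 * (A * C - B\<^sup>2)"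
    by (simp add: qform_def pq A_def B_def C_def power2_eq_square algebra_simps)
  also have "\<dots> = (A * p - B * q)\<^sup>2 + q\<^sup>2" by (simp add: AC)
  also have "\<dots> > 0"
    using A u by (cases "q = 0") (auto simp: pq add_nonneg_pos)
  finally show ?thesis using A by (simp add: zero_less_mult_iff)
qed

lemma H2_lift:
  assumes "u \<in> H2" shows "u \<in> H3" "snd (lift u) $ 2 = 0" "lift u \<in> hyperboloid"
  using assms by (simp_all add: H2_def lift_in_hyperboloid) (simp add: lift_def)

text \<open>For a future null vector \<open>(n, (m, 0, l))\<close> with \<open>l \<noteq> n\<close> the stereographic projection gives \<open>m / (n - l)\<close>, and
  \<open>n\<^sup>2 = m\<^sup>2 + l\<^sup>2\<close> turns the quadratic form into \<open>n - l\<close> times a square. The case \<open>l = n\<close> is the pole.\<close>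

lemma ray_spinor:
  assumes u: "x a \<in> H2" and v: "x b \<in> H2" and "x a \<noteq> x b"
  shows "p_pair x a b = linear_form (of_real_pair (spinor x a b))"
    and "spinor x a b \<noteq> (0, 0)"
    and "\<exists>\<kappa>>0. \<forall>p q. qform (lift (x b)) p q - exp (- hdist (x a) (x b)) * qform (lift (x a)) p q
      = \<kappa> * (bracket p (spinor x a b) * bracket q (spinor x a b))"
proof -
  define N where "N = lift (x b) - exp (- hdist (x a) (x b)) *\<^sub>R lift (x a)"
  note r = ray_end_eq[OF H2_lift(1)[OF u] H2_lift(1)[OF v] assms(3), folded N_def]
  define n m l where "n = fst N" and "m = snd N $ 1" and "l = snd N $ 3"
  have N2: "snd N $ 2 = 0" using H2_lift(2)[OF u] H2_lift(2)[OF v] by (simp add: N_def)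
  have n: "n > 0" "n\<^sup>2 = m\<^sup>2 + l\<^sup>2"
    using r(1,2) N2 by (simp_all add: n_def m_def l_def mink_def inner_plane power2_eq_square)
  have xi: "ray_end (x a) (x b) $ 1 = m / n" "ray_end (x a) (x b) $ 2 = 0" "ray_end (x a) (x b) $ 3 = l / n"
    using N2 by (simp_all add: r(3) n_def m_def l_def)
  have goal3: "\<exists>\<kappa>>0. \<forall>p q. qform N p q = \<kappa> * (bracket p (spinor x a b) * bracket q (spinor x a b))"
    and goal12: "p_pair x a b = linear_form (of_real_pair (spinor x a b)) \<and> spinor x a b \<noteq> (0, 0)"
  proof -
    consider (inf) "l = n" "m = 0" | (fin) "l < n"
    proof -
      have "l\<^sup>2 \<le> n\<^sup>2" using n by simp
      then have "l \<le> n" using power2_le_imp_le[of l n] n by simp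
      then show thesis using that n by (cases "l = n") auto
    qed
    then have "(\<exists>\<kappa>>0. \<forall>p q. qform N p q = \<kappa> * (bracket p (spinor x a b) * bracket q (spinor x a b))) \<and>
      p_pair x a b = linear_form (of_real_pair (spinor x a b)) \<and> spinor x a b \<noteq> (0, 0)"
    proof cases
      case inf
      then have "ray_end (x a) (x b) = vector [0, 0, 1]"
        using xi n by (simp add: Finite_Cartesian_Product.vec_eq_iff forall_3)
      then have t: "t_end x a b = None" by (simp add: t_end_def stereo_def)
      have "qform N p q = 2 * n * (bracket p (-1, 0) * bracket q (-1, 0))" for p q
        using inf by (simp add: qform_def bracket_def flip: n_def m_def l_def)
      then show ?thesis using n t
        by (intro conjI exI[of _ "2 * n"]) (auto simp: spinor_def p_pair_def linear_form_def of_real_pair_def)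
    next
      case fin
      have "ray_end (x a) (x b) $ 3 \<noteq> 1" using fin n by (simp add: xi)
      then have "ray_end (x a) (x b) \<noteq> vector [0, 0, 1]" by auto
      then have t: "t_end x a b = Some (of_real (m / (n - l)))"
        using n fin by (simp add: t_end_def stereo_def xi complex_eq_iff field_simps)
      define \<tau> where "\<tau> = m / (n - l)"
      have \<tau>: "(n - l) * \<tau> = m" "(n - l) * (\<tau> * \<tau>) = n + l"
      proof -
        show 1: "(n - l) * \<tau> = m" using fin by (simp add: \<tau>_def)
        have "(n - l) * ((n - l) * (\<tau> * \<tau>)) = m\<^sup>2" by (simp add: power2_eq_square flip: 1)
        also have "\<dots> = (n - l) * (n + l)" using n by (simp add: power2_eq_square algebra_simps)
        finally show "(n - l) * (\<tau> * \<tau>) = n + l" using fin by simp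
      qed
      have "qform N p q = (n - l) * (bracket p (\<tau>, 1) * bracket q (\<tau>, 1))" for p q
      proof -
        have "(n - l) * (bracket p (\<tau>, 1) * bracket q (\<tau>, 1)) = fst p * fst q * (n - l)
          - (fst p * snd q + snd p * fst q) * ((n - l) * \<tau>) + snd p * snd q * ((n - l) * (\<tau> * \<tau>))"
          by (simp add: bracket_def algebra_simps)
        then show ?thesis unfolding \<tau> by (simp add: qform_def flip: n_def m_def l_def)
      qed
      then show ?thesis using fin t
        by (intro conjI exI[of _ "n - l"]) (auto simp: spinor_def p_pair_def linear_form_def of_real_pair_def \<tau>_def)
    qed
    then show "\<exists>\<kappa>>0. \<forall>p q. qform N p q = \<kappa> * (bracket p (spinor x a b) * bracket q (spinor x a b))"
      and "p_pair x a b = linear_form (of_real_pair (spinor x a b)) \<and> spinor x a b \<noteq> (0, 0)" by blast+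
  qed
  from goal12 show "p_pair x a b = linear_form (of_real_pair (spinor x a b))" "spinor x a b \<noteq> (0, 0)" by blast+
  from goal3 show "\<exists>\<kappa>>0. \<forall>p q. qform (lift (x b)) p q - exp (- hdist (x a) (x b)) * qform (lift (x a)) p q
      = \<kappa> * (bracket p (spinor x a b) * bracket q (spinor x a b))"
    by (simp add: N_def qform_linear)
qed

section \<open>Convex position\<close>

definition convex_position :: "(nat \<Rightarrow> real ^ 3) \<Rightarrow> bool" where
  "convex_position x \<longleftrightarrow> (\<forall>a\<in>{1..4}. x a \<notin> hyp_convex hull (x ` ({1..4} - {a})))"

lemma sum_permuted_4:
  fixes f :: "nat \<Rightarrow> 'a :: comm_monoid_add"
  assumes "{1..4} = {i, j, k, l :: nat}"
  shows "(\<Sum>a\<in>{1..4}. f a) = f i + f j + f k + f l"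
proof -
  have "card {i, j, k, l} = 4" using assms by (metis card_atLeastAtMost diff_Suc_1 numeral_eq_Suc pred_numeral_simps(2))
  then have "distinct [i, j, k, l]" by (intro card_distinct) simp
  then show ?thesis unfolding assms by (simp add: add.assoc)
qed

text \<open>Otherwise \<open>x i\<close> would be a nonnegative combination of the other three points, hence in their hull.\<close>

lemma no_single_negative:
  assumes x: "x \<in> configs 4 H2" "convex_position x"
    and ijkl: "{1..4} = {i, j, k, l}"
    and sum: "(\<Sum>a\<in>{1..4}. c a *\<^sub>R lift (x a)) = 0"
    and neg: "c i < 0"
  shows "\<not> (c j \<ge> 0 \<and> c k \<ge> 0 \<and> c l \<ge> 0)"
proof
  assume pos: "c j \<ge> 0 \<and> c k \<ge> 0 \<and> c l \<ge> 0"
  have H: "x a \<in> H3" if "a \<in> {1..4}" for a using x(1) that by (auto simp: configs_def H2_def)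
  have "c i *\<^sub>R lift (x i) + c j *\<^sub>R lift (x j) + c k *\<^sub>R lift (x k) + c l *\<^sub>R lift (x l) = 0"
    using sum sum_permuted_4[OF ijkl, of "\<lambda>a. c a *\<^sub>R lift (x a)"] by simp
  then have "(- c i) *\<^sub>R lift (x i) = c j *\<^sub>R lift (x j) + c k *\<^sub>R lift (x k) + c l *\<^sub>R lift (x l)"
    by (simp only: scaleR_minus_left neg_eq_iff_add_eq_0 add.assoc)
  then have "(1 / - c i) *\<^sub>R ((- c i) *\<^sub>R lift (x i)) =
      (1 / - c i) *\<^sub>R (c j *\<^sub>R lift (x j) + c k *\<^sub>R lift (x k) + c l *\<^sub>R lift (x l))" by simp
  then have eq: "lift (x i) = (c j / - c i) *\<^sub>R lift (x j) + (c k / - c i) *\<^sub>R lift (x k) + (c l / - c i) *\<^sub>R lift (x l)"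
    using neg by (simp add: scaleR_add_right)
  have "i \<in> {1..4}" using ijkl by auto
  have "card {i, j, k, l} = 4" unfolding ijkl[symmetric] by simp
  then have "distinct [i, j, k, l]" by (intro card_distinct) simp
  then have S: "{1..4} - {i} = {j, k, l}" using ijkl by auto
  have "x i \<in> C" if "hyp_convex C" "x ` {j, k, l} \<subseteq> C" for C
    by (rule hyp_convex_triangle[OF that(1) _ _ _ H[OF \<open>i \<in> {1..4}\<close>] _ _ _ eq])
      (use that pos neg in \<open>auto simp: divide_nonneg_neg\<close>)
  then have "x i \<in> hyp_convex hull (x ` ({1..4} - {i}))" unfolding S hull_def by blast
  then show False using x(2) \<open>i \<in> {1..4}\<close> by (auto simp: convex_position_def)
qed

text \<open>The time components of the points are positive, which excludes relations with coefficients of one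
  sign only. In particular no three of the points are linearly dependent.\<close>

lemma dependency_signs:
  assumes x: "x \<in> configs 4 H2" "convex_position x"
    and sum: "(\<Sum>a\<in>{1..4}. c a *\<^sub>R lift (x a)) = 0" and nz: "\<exists>a\<in>{1..4}. c a \<noteq> 0"
  shows "(c 1 > 0 \<and> c 2 > 0 \<and> c 3 < 0 \<and> c 4 < 0) \<or> (c 1 > 0 \<and> c 2 < 0 \<and> c 3 > 0 \<and> c 4 < 0) \<or>
    (c 1 > 0 \<and> c 2 < 0 \<and> c 3 < 0 \<and> c 4 > 0) \<or> (c 1 < 0 \<and> c 2 < 0 \<and> c 3 > 0 \<and> c 4 > 0) \<or>
    (c 1 < 0 \<and> c 2 > 0 \<and> c 3 < 0 \<and> c 4 > 0) \<or> (c 1 < 0 \<and> c 2 > 0 \<and> c 3 > 0 \<and> c 4 < 0)"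
proof -
  have sets: "{1..4} = {1, 2, 3, 4 :: nat}" "{1..4} = {2, 1, 3, 4 :: nat}" "{1..4} = {3, 1, 2, 4 :: nat}" "{1..4} = {4, 1, 2, 3 :: nat}"
    by auto
  have sum': "(\<Sum>a\<in>{1..4}. (- c a) *\<^sub>R lift (x a)) = 0" using sum by (simp add: sum_negf)
  note N = sets[THEN no_single_negative[OF x _ sum]] sets[THEN no_single_negative[OF x _ sum']]
  have not_nonneg: "\<not> (d 1 \<ge> 0 \<and> d 2 \<ge> 0 \<and> d 3 \<ge> 0 \<and> d 4 \<ge> 0)"
    if d: "(\<Sum>a\<in>{1..4}. d a *\<^sub>R lift (x a)) = 0" "\<exists>a\<in>{1..4}. d a \<noteq> 0" for d
  proof
    assume nn: "d 1 \<ge> 0 \<and> d 2 \<ge> 0 \<and> d 3 \<ge> 0 \<and> d 4 \<ge> 0"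
    have p: "fst (lift (x a)) > 0" if "a \<in> {1..4}" for a
    proof -
      have "x a \<in> H2" using x(1) that by (auto simp: configs_def)
      then show ?thesis using H2_lift(3) by (auto simp: hyperboloid_def)
    qed
    have dn: "d a \<ge> 0" if "a \<in> {1..4}" for a using nn that unfolding sets(1) by auto
    have "(\<Sum>a\<in>{1..4}. d a * fst (lift (x a))) = fst (\<Sum>a\<in>{1..4}. d a *\<^sub>R lift (x a))"
      by (simp add: fst_sum)
    also have "\<dots> = 0" unfolding d(1) by simp
    finally have "\<forall>a\<in>{1..4}. d a * fst (lift (x a)) = 0"
      using dn p by (subst (asm) sum_nonneg_eq_0_iff) (auto simp: less_imp_le)
    then show False using d(2) p by fastforce
  qed
  have M: "\<not> (c 1 \<ge> 0 \<and> c 2 \<ge> 0 \<and> c 3 \<ge> 0 \<and> c 4 \<ge> 0)"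
    "\<not> (- c 1 \<ge> 0 \<and> - c 2 \<ge> 0 \<and> - c 3 \<ge> 0 \<and> - c 4 \<ge> 0)"
    using not_nonneg[OF sum nz] not_nonneg[OF sum'] nz by auto
  show ?thesis using N M by smt
qed


text \<open>Four vectors in a space of dimension three are dependent. The sign pattern of the dependency tells
  which vertices are opposite, and \<open>\<pi>\<close> moves them to \<open>1, 3\<close> and \<open>2, 4\<close>.\<close>

lemma crossing_relation:
  assumes x: "x \<in> configs 4 H2" "convex_position x"
  obtains \<pi> c where "\<pi> permutes {1..4}" "\<And>a :: nat. a \<in> {1..4} \<Longrightarrow> c a > (0 :: real)"
    "c 1 *\<^sub>R lift (x (\<pi> 1)) + c 3 *\<^sub>R lift (x (\<pi> 3)) = c 2 *\<^sub>R lift (x (\<pi> 2)) + c 4 *\<^sub>R lift (x (\<pi> 4))"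
proof -
  define f where "f a = (fst (lift (x a)), snd (lift (x a)) $ 1, snd (lift (x a)) $ 3)" for a
  have H: "x a \<in> H2" if "a \<in> {1..4}" for a using x(1) that by (auto simp: configs_def)
  note plane = H2_lift[OF H]
  have inj: "inj_on f {1..4}"
  proof (rule inj_onI)
    fix a b :: nat assume ab: "a \<in> {1..4}" "b \<in> {1..4}" "f a = f b"
    have "lift (x a) = lift (x b)"
      using ab(3) plane(2)[OF ab(1)] plane(2)[OF ab(2)]
      by (auto simp: f_def prod_eq_iff Finite_Cartesian_Product.vec_eq_iff forall_3)
    then have "x a = x b" using to_ball_lift plane(1) ab by metis
    then show "a = b" using x(1) ab by (auto simp: configs_def inj_on_def)
  qed
  have "dependent (f ` {1..4})"
    using card_image[OF inj] by (intro dependent_biggerset) simp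
  then obtain u where u: "\<exists>v\<in>f ` {1..4}. u v \<noteq> 0" "(\<Sum>v\<in>f ` {1..4}. u v *\<^sub>R v) = 0"
    by (auto simp: dependent_finite)
  define c where "c a = u (f a)" for a
  have nz: "\<exists>a\<in>{1..4}. c a \<noteq> 0" using u(1) by (auto simp: c_def)
  have fsum: "(\<Sum>a\<in>{1..4}. c a *\<^sub>R f a) = 0"
    using u(2) unfolding c_def by (simp only: sum.reindex[OF inj] comp_def)
  have "(\<Sum>a\<in>{1..4}. c a * fst (lift (x a))) = 0" "(\<Sum>a\<in>{1..4}. c a * snd (lift (x a)) $ 1) = 0"
    "(\<Sum>a\<in>{1..4}. c a * snd (lift (x a)) $ 3) = 0"
    using arg_cong[OF fsum, of fst] arg_cong[OF fsum, of "\<lambda>v. fst (snd v)"] arg_cong[OF fsum, of "\<lambda>v. snd (snd v)"]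
    by (simp_all add: f_def fst_sum snd_sum)
  moreover have "(\<Sum>a\<in>{1..4}. c a * snd (lift (x a)) $ 2) = 0"
    using plane(2) by (intro sum.neutral) simp
  ultimately have sum: "(\<Sum>a\<in>{1..4}. c a *\<^sub>R lift (x a)) = 0"
    by (simp add: prod_eq_iff fst_sum snd_sum Finite_Cartesian_Product.vec_eq_iff forall_3 sum_component)
  note result = that
  have finish: thesis
    if \<pi>: "\<pi> permutes {1..4}" and s: "s = 1 \<or> s = - 1"
      and pos: "s * c (\<pi> 1) > 0" "s * c (\<pi> 3) > 0" "s * c (\<pi> 2) < 0" "s * c (\<pi> 4) < 0" for \<pi> and s :: real
  proof (rule result[OF \<pi>, of "\<lambda>a. \<bar>c (\<pi> a)\<bar>"])
    have "{1..4} = {\<pi> 1, \<pi> 2, \<pi> 3, \<pi> 4}"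
    proof -
      have "{1..4} = {1, 2, 3, 4 :: nat}" by auto
      then show ?thesis using permutes_image[OF \<pi>] by auto
    qed
    from sum_permuted_4[OF this, of "\<lambda>a. c a *\<^sub>R lift (x a)"]
    have 0: "c (\<pi> 1) *\<^sub>R lift (x (\<pi> 1)) + c (\<pi> 2) *\<^sub>R lift (x (\<pi> 2)) + c (\<pi> 3) *\<^sub>R lift (x (\<pi> 3))
        + c (\<pi> 4) *\<^sub>R lift (x (\<pi> 4)) = 0"
      using sum by simp
    have abs: "\<bar>c (\<pi> 1)\<bar> = s * c (\<pi> 1)" "\<bar>c (\<pi> 3)\<bar> = s * c (\<pi> 3)" "\<bar>c (\<pi> 2)\<bar> = - (s * c (\<pi> 2))" "\<bar>c (\<pi> 4)\<bar> = - (s * c (\<pi> 4))"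
      using s pos by auto
    have "\<bar>c (\<pi> 1)\<bar> *\<^sub>R lift (x (\<pi> 1)) + \<bar>c (\<pi> 3)\<bar> *\<^sub>R lift (x (\<pi> 3))
        - (\<bar>c (\<pi> 2)\<bar> *\<^sub>R lift (x (\<pi> 2)) + \<bar>c (\<pi> 4)\<bar> *\<^sub>R lift (x (\<pi> 4)))
      = s *\<^sub>R (c (\<pi> 1) *\<^sub>R lift (x (\<pi> 1)) + c (\<pi> 2) *\<^sub>R lift (x (\<pi> 2)) + c (\<pi> 3) *\<^sub>R lift (x (\<pi> 3))
        + c (\<pi> 4) *\<^sub>R lift (x (\<pi> 4)))"
      unfolding abs by (simp add: scaleR_add_right)
    then show "\<bar>c (\<pi> 1)\<bar> *\<^sub>R lift (x (\<pi> 1)) + \<bar>c (\<pi> 3)\<bar> *\<^sub>R lift (x (\<pi> 3)) =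
        \<bar>c (\<pi> 2)\<bar> *\<^sub>R lift (x (\<pi> 2)) + \<bar>c (\<pi> 4)\<bar> *\<^sub>R lift (x (\<pi> 4))"
      by (simp only: 0 scaleR_zero_right right_minus_eq)
    fix a :: nat assume "a \<in> {1..4}"
    then have "a = 1 \<or> a = 2 \<or> a = 3 \<or> a = 4" by auto
    then show "\<bar>c (\<pi> a)\<bar> > 0" using pos by auto
  qed
  have p: "id permutes {1..4 :: nat}" "Transposition.transpose 2 3 permutes {1..4 :: nat}" "Transposition.transpose 3 4 permutes {1..4 :: nat}"
    by (auto intro!: permutes_id permutes_swap_id)
  have tr: "Transposition.transpose 2 3 1 = (1::nat)" "Transposition.transpose 2 3 2 = (3::nat)" "Transposition.transpose 2 3 3 = (2::nat)" "Transposition.transpose 2 3 4 = (4::nat)"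
    "Transposition.transpose 3 4 1 = (1::nat)" "Transposition.transpose 3 4 2 = (2::nat)" "Transposition.transpose 3 4 3 = (4::nat)" "Transposition.transpose 3 4 4 = (3::nat)"
    by (simp_all add: Transposition.transpose_def)
  show thesis
    using dependency_signs[OF x sum nz] finish[OF p(1), of 1] finish[OF p(1), of "-1"]
      finish[OF p(2), of 1] finish[OF p(2), of "-1"] finish[OF p(3), of 1] finish[OF p(3), of "-1"]
    unfolding tr id_apply by (elim disjE) simp_all
qed

lemma convex_position_permute:
  assumes x: "x \<in> configs 4 H2" "convex_position x" and \<pi>: "\<pi> permutes {1..4}"
  shows "x \<circ> \<pi> \<in> configs 4 H2" "convex_position (x \<circ> \<pi>)"
proof -
  have in4: "\<pi> a \<in> {1..4}" if "a \<in> {1..4}" for a using permutes_in_image[OF \<pi>] that by blast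
  have inj: "inj \<pi>" using permutes_inj[OF \<pi>] .
  show "x \<circ> \<pi> \<in> configs 4 H2"
  proof -
    have "inj_on (x \<circ> \<pi>) {1..4}"
    proof (rule comp_inj_on)
      show "inj_on \<pi> {1..4}" using inj by (rule inj_on_subset) simp
      show "inj_on x (\<pi> ` {1..4})" unfolding permutes_image[OF \<pi>] using x(1) by (simp add: configs_def)
    qed
    moreover have "x \<circ> \<pi> \<in> {1..4} \<rightarrow> H2"
      using x(1) in4 unfolding configs_def by (simp add: Pi_iff del: atLeastAtMost_iff)
    ultimately show ?thesis by (simp add: configs_def)
  qed
  have "(x \<circ> \<pi>) ` ({1..4} - {a}) = x ` ({1..4} - {\<pi> a})" for a
    unfolding image_comp[symmetric] image_set_diff[OF inj] permutes_image[OF \<pi>] by simp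
  then show "convex_position (x \<circ> \<pi>)"
    using x(2) in4 by (simp add: convex_position_def del: atLeastAtMost_iff)
qed

section \<open>The lower bound\<close>

lemma hdist_commute: "hdist u v = hdist v u"
  by (simp add: hdist_def norm_minus_commute mult.commute)

lemma spinor_permute: "spinor (x \<circ> \<pi>) a b = spinor x (\<pi> a) (\<pi> b)"
  by (simp add: spinor_def t_end_def)

lemma bracket_eq_0_imp:
  fixes u v :: "real \<times> real" assumes "bracket u v = 0" "u \<noteq> (0, 0)" shows "\<exists>\<mu>. v = \<mu> *\<^sub>R u"
proof (cases "fst u = 0")
  case True
  then show ?thesis using assms
    by (intro exI[of _ "snd v / snd u"]) (auto simp: bracket_def prod_eq_iff)
next
  case False
  then show ?thesis using assms
    by (intro exI[of _ "fst v / fst u"]) (auto simp: bracket_def prod_eq_iff field_simps)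
qed

lemma ray_forms:
  assumes "x \<in> configs 4 H2"
  obtains \<kappa> where "\<And>a b u v. a \<in> {1..4} \<Longrightarrow> b \<in> {1..4} \<Longrightarrow> a \<noteq> b \<Longrightarrow>
      qform (lift (x b)) u v - exp (- hdist (x a) (x b)) * qform (lift (x a)) u v
      = \<kappa> a b * (bracket u (spinor x a b) * bracket v (spinor x a b))"
    and "\<And>a b. a \<in> {1..4} \<Longrightarrow> b \<in> {1..4} \<Longrightarrow> a \<noteq> b \<Longrightarrow>
      0 < exp (- hdist (x a) (x b)) \<and> exp (- hdist (x a) (x b)) < 1 \<and> \<kappa> a b > 0"
proof -
  have H: "x a \<in> H2" if "a \<in> {1..4}" for a using assms that by (auto simp: configs_def)
  have ne: "x a \<noteq> x b" if "a \<in> {1..4}" "b \<in> {1..4}" "a \<noteq> b" for a b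
    using assms that by (auto simp: configs_def inj_on_def)
  define Q where "Q a b \<kappa> \<longleftrightarrow> \<kappa> > 0 \<and> (\<forall>u v. qform (lift (x b)) u v - exp (- hdist (x a) (x b)) * qform (lift (x a)) u v
      = \<kappa> * (bracket u (spinor x a b) * bracket v (spinor x a b)))" for a b \<kappa>
  define \<kappa> where "\<kappa> a b = (SOME r. Q a b r)" for a b
  have "Q a b (\<kappa> a b)" if "a \<in> {1..4}" "b \<in> {1..4}" "a \<noteq> b" for a b
    unfolding \<kappa>_def using ray_spinor(3)[OF H[OF that(1)] H[OF that(2)] ne[OF that]]
    by (intro someI_ex[of "Q a b"]) (auto simp: Q_def)
  moreover have "hdist (x a) (x b) > 0" if "a \<in> {1..4}" "b \<in> {1..4}" "a \<noteq> b" for a b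
    using hdist_pos H2_lift(1)[OF H] ne that by blast
  ultimately show thesis unfolding Q_def by (intro that[of \<kappa>]) (simp_all del: split_paired_All)
qed

text \<open>The second alternative is the first one with the labels \<open>2\<close> and \<open>4\<close> exchanged. The two products have
  opposite signs, as the diagonal \<open>24\<close> crosses the line of the other diagonal. They do not
  vanish: the two ends of that line are distinct because the form of \<open>Z\<close> is definite, and none of them is
  an end of the diagonal \<open>24\<close>, as otherwise \<open>x 2\<close> would lie on that line, against \<open>dependency_signs\<close>.\<close>

lemma crossing_orientation:
  assumes x: "x \<in> configs 4 H2" "convex_position x" and c: "\<And>a :: nat. a \<in> {1..4} \<Longrightarrow> c a > (0 :: real)"
    and rel: "c 1 *\<^sub>R lift (x 1) + c 3 *\<^sub>R lift (x 3) = c 2 *\<^sub>R lift (x 2) + c 4 *\<^sub>R lift (x 4)"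
  shows "bracket (spinor x 3 1) (spinor x 4 2) * bracket (spinor x 4 2) (spinor x 1 3) * bracket (spinor x 3 1) (spinor x 1 3) > 0
    \<or> bracket (spinor x 3 1) (spinor x 2 4) * bracket (spinor x 2 4) (spinor x 1 3) * bracket (spinor x 3 1) (spinor x 1 3) > 0"
proof -
  let ?sq = "\<lambda>d u v. bracket u d * bracket v d"
  define w where "w = spinor x"
  define X where "X a = qform (lift (x a))" for a
  define k where "k a b = exp (- hdist (x a) (x b))" for a b
  define Z where "Z u v = c 1 * X 1 u v + c 3 * X 3 u v" for u v
  obtain \<kappa> where ray: "\<And>a b u v. a \<in> {1..4} \<Longrightarrow> b \<in> {1..4} \<Longrightarrow> a \<noteq> b \<Longrightarrow>
      X b u v - k a b * X a u v = \<kappa> a b * ?sq (w a b) u v"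
    and k: "\<And>a b. a \<in> {1..4} \<Longrightarrow> b \<in> {1..4} \<Longrightarrow> a \<noteq> b \<Longrightarrow> 0 < k a b \<and> k a b < 1 \<and> \<kappa> a b > 0"
    using ray_forms[OF x(1)] unfolding X_def k_def w_def by metis
  have k_commute: "k a b = k b a" for a b by (simp add: k_def hdist_commute)
  have Z24: "Z u v = c 2 * X 2 u v + c 4 * X 4 u v" for u v
    unfolding Z_def X_def qform_linear[symmetric] rel ..
  have r13: "\<And>u v. X 1 u v - k 1 3 * X 3 u v = \<kappa> 3 1 * ?sq (w 3 1) u v" "\<And>u v. X 3 u v - k 1 3 * X 1 u v = \<kappa> 1 3 * ?sq (w 1 3) u v"
    using ray[of 3 1] ray[of 1 3] k_commute[of 3 1] by auto
  have r24: "\<And>u v. X 2 u v - k 2 4 * X 4 u v = \<kappa> 4 2 * ?sq (w 4 2) u v" "\<And>u v. X 4 u v - k 2 4 * X 2 u v = \<kappa> 2 4 * ?sq (w 2 4) u v"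
    using ray[of 4 2] ray[of 2 4] k_commute[of 4 2] by auto
  have c4: "c 1 > 0" "c 2 > 0" "c 3 > 0" "c 4 > 0" using c by auto
  have kk: "0 < k 1 3" "k 1 3 < 1" "0 < k 2 4" "k 2 4 < 1" "\<kappa> 1 3 > 0" "\<kappa> 3 1 > 0" "\<kappa> 2 4 > 0" "\<kappa> 4 2 > 0"
    using k[of 1 3] k[of 3 1] k[of 2 4] k[of 4 2] by auto
  note v1 = diagonal_decomposition[OF r13 Z_def kk(1,2,6,5) c4(1,3)]
  note v2 = diagonal_decomposition[OF r24 Z24 kk(3,4,8,7) c4(2,4)]
  obtain \<alpha>1 \<alpha>3 where \<alpha>: "\<alpha>1 > 0" "\<alpha>3 > 0" "\<And>u v. Z u v = \<alpha>1 * ?sq (w 3 1) u v + \<alpha>3 * ?sq (w 1 3) u v"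
    using v1(3) by blast
  obtain \<alpha>2 \<alpha>4 where \<beta>: "\<alpha>2 > 0" "\<alpha>4 > 0" "\<And>u v. Z u v = \<alpha>2 * ?sq (w 4 2) u v + \<alpha>4 * ?sq (w 2 4) u v"
    using v2(3) by blast
  obtain \<rho> \<nu> where X2: "\<nu> > 0" "\<And>u v. X 2 u v = \<rho> * Z u v + \<nu> * ?sq (w 4 2) u v"
    using v2(1) by blast
  have H: "x a \<in> H2" if "a \<in> {1..4}" for a using x(1) that by (auto simp: configs_def)
  have ne: "x 1 \<noteq> x 3" using x(1) inj_onD[of x "{1..4}" 1 3] by (auto simp: configs_def)
  have w0: "w 3 1 \<noteq> (0, 0)" "w 1 3 \<noteq> (0, 0)"
    using ray_spinor(2)[of x 3 1] ray_spinor(2)[of x 1 3] H ne by (auto simp: w_def)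
  \<comment> \<open>A relation without \<open>x 4\<close> has the coefficient \<open>0\<close>, which is not one of the possible patterns.\<close>
  have not_span: "\<not> (\<forall>u v. X 2 u v = r * X 1 u v + s * X 3 u v)" for r s
  proof
    assume eq: "\<forall>u v. X 2 u v = r * X 1 u v + s * X 3 u v"
    have "lift (x 2) = r *\<^sub>R lift (x 1) + s *\<^sub>R lift (x 3)"
      using eq H2_lift(2)[OF H] by (intro qform_eq_imp_eq) (simp_all add: qform_linear X_def del: split_paired_All)
    moreover have "{1..4} = {1, 2, 3, 4 :: nat}" by auto
    moreover define d where "d = (\<lambda>a :: nat. if a = 1 then r else if a = 2 then - 1 else if a = 3 then s else 0)"
    ultimately have "(\<Sum>a\<in>{1..4}. d a *\<^sub>R lift (x a)) = 0"
      by simp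
    moreover have "\<exists>a\<in>{1..4}. d a \<noteq> 0" by (rule bexI[of _ 2]) (simp_all add: d_def)
    ultimately show False using dependency_signs[OF x, of d] by (simp add: d_def)
  qed
  have b13: "bracket (w 3 1) (w 1 3) \<noteq> 0"
  proof
    assume "bracket (w 3 1) (w 1 3) = 0"
    then have "Z (w 3 1) (w 3 1) = 0" by (simp add: \<alpha>(3) bracket_simps(7))
    moreover have "X a (w 3 1) (w 3 1) > 0" if "a \<in> {1..4}" for a
      unfolding X_def using H2_lift[OF H[OF that]] w0 by (intro qform_pos)
    then have "Z (w 3 1) (w 3 1) > 0" unfolding Z_def using c4 by (intro add_pos_pos mult_pos_pos) auto
    ultimately show False by simp
  qed
  have b12: "bracket (w 3 1) (w 4 2) \<noteq> 0"
  proof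
    assume "bracket (w 3 1) (w 4 2) = 0"
    then obtain \<mu> where \<mu>: "w 4 2 = \<mu> *\<^sub>R w 3 1" using bracket_eq_0_imp w0 by blast
    define m where "m = \<mu> * \<mu> / \<kappa> 3 1"
    have eq: "?sq (w 4 2) u v = m * (X 1 u v - k 1 3 * X 3 u v)" for u v
      unfolding r13(1) using kk by (simp add: \<mu> bracket_simps m_def)
    have "X 2 u v = (\<rho> * c 1 + \<nu> * m) * X 1 u v + (\<rho> * c 3 - \<nu> * m * k 1 3) * X 3 u v" for u v
      unfolding X2(2) Z_def eq by (simp add: algebra_simps)
    then show False using not_span by blast
  qed
  have b32: "bracket (w 4 2) (w 1 3) \<noteq> 0"
  proof
    assume "bracket (w 4 2) (w 1 3) = 0"
    then have "bracket (w 1 3) (w 4 2) = 0" using bracket_commute[of "w 1 3" "w 4 2"] by simp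
    then obtain \<mu> where \<mu>: "w 4 2 = \<mu> *\<^sub>R w 1 3" using bracket_eq_0_imp w0 by blast
    define m where "m = \<mu> * \<mu> / \<kappa> 1 3"
    have eq: "?sq (w 4 2) u v = m * (X 3 u v - k 1 3 * X 1 u v)" for u v
      unfolding r13(2) using kk by (simp add: \<mu> bracket_simps m_def)
    have "X 2 u v = (\<rho> * c 1 - \<nu> * m * k 1 3) * X 1 u v + (\<rho> * c 3 + \<nu> * m) * X 3 u v" for u v
      unfolding X2(2) Z_def eq by (simp add: algebra_simps)
    then show False using not_span by blast
  qed
  define P where "P = bracket (w 3 1) (w 4 2) * bracket (w 4 2) (w 1 3) * bracket (w 3 1) (w 1 3)"
  define P' where "P' = bracket (w 3 1) (w 2 4) * bracket (w 2 4) (w 1 3) * bracket (w 3 1) (w 1 3)"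
  have "\<alpha>2 * (bracket (w 3 1) (w 4 2) * bracket (w 4 2) (w 1 3)) + \<alpha>4 * (bracket (w 3 1) (w 2 4) * bracket (w 2 4) (w 1 3)) = 0"
    using \<alpha>(3)[of "w 3 1" "w 1 3"] \<beta>(3)[of "w 3 1" "w 1 3"] bracket_commute[of "w 1 3" "w 4 2"]
      bracket_commute[of "w 1 3" "w 2 4"]
    by (simp add: bracket_simps(7))
  moreover have "\<alpha>2 * P + \<alpha>4 * P' = (\<alpha>2 * (bracket (w 3 1) (w 4 2) * bracket (w 4 2) (w 1 3))
      + \<alpha>4 * (bracket (w 3 1) (w 2 4) * bracket (w 2 4) (w 1 3))) * bracket (w 3 1) (w 1 3)"
    unfolding P_def P'_def by (simp only: distrib_right mult.assoc)
  ultimately have "\<alpha>2 * P + \<alpha>4 * P' = 0" by (simp only: mult_zero_left)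
  moreover have "P \<noteq> 0" using b12 b13 b32 by (simp add: P_def)
  ultimately have "P > 0 \<or> P' > 0"
    using \<beta>(1,2) mult_pos_neg[of \<alpha>2 P] mult_nonneg_nonpos[of \<alpha>4 P'] by linarith
  then show ?thesis by (simp add: P_def P'_def w_def)
qed

lemma AS_det_ge_1_oriented:
  assumes x: "x \<in> configs 4 H2" and c: "\<And>a :: nat. a \<in> {1..4} \<Longrightarrow> c a > (0 :: real)"
    and rel: "c 1 *\<^sub>R lift (x 1) + c 3 *\<^sub>R lift (x 3) = c 2 *\<^sub>R lift (x 2) + c 4 *\<^sub>R lift (x 4)"
    and orient: "bracket (spinor x 3 1) (spinor x 4 2) * bracket (spinor x 4 2) (spinor x 1 3) * bracket (spinor x 3 1) (spinor x 1 3) > 0"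
  shows "cmod (AS_det 4 x) \<ge> 1"
proof -
  obtain \<kappa> where ray: "\<And>a b u v. a \<in> {1..4} \<Longrightarrow> b \<in> {1..4} \<Longrightarrow> a \<noteq> b \<Longrightarrow>
      qform (lift (x b)) u v - exp (- hdist (x a) (x b)) * qform (lift (x a)) u v
      = \<kappa> a b * (bracket u (spinor x a b) * bracket v (spinor x a b))"
    and k: "\<And>a b. a \<in> {1..4} \<Longrightarrow> b \<in> {1..4} \<Longrightarrow> a \<noteq> b \<Longrightarrow>
      0 < exp (- hdist (x a) (x b)) \<and> exp (- hdist (x a) (x b)) < 1 \<and> \<kappa> a b > 0"
    using ray_forms[OF x] by blast
  have Z24: "qform (c 1 *\<^sub>R lift (x 1) + c 3 *\<^sub>R lift (x 3)) u v
      = c 2 * qform (lift (x 2)) u v + c 4 * qform (lift (x 4)) u v" for u v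
    unfolding rel by (simp add: qform_linear)
  have Z13: "qform (c 1 *\<^sub>R lift (x 1) + c 3 *\<^sub>R lift (x 3)) u v
      = c 1 * qform (lift (x 1)) u v + c 3 * qform (lift (x 3)) u v" for u v
    by (simp add: qform_linear)
  have k_commute: "exp (- hdist (x a) (x b)) = exp (- hdist (x b) (x a))" for a b
    by (simp add: hdist_commute)
  obtain D e where e: "\<And>a b. \<bar>e a b\<bar> = (1 :: real)"
    and D: "\<And>i j. i \<le> j \<Longrightarrow> j \<le> 4 \<Longrightarrow> bracket (D i) (D j) \<ge> 0"
      "\<And>i j. i < j \<Longrightarrow> j \<le> 3 \<Longrightarrow> bracket (D i) (D j) > 0" "bracket (D 3) (D 4) > 0"
    and sector: "\<And>a b. a \<in> {1..4} \<Longrightarrow> b \<in> {1..4} \<Longrightarrow> a \<noteq> b \<Longrightarrow>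
      in_sector D (position a b) (e a b *\<^sub>R spinor x a b)"
    by (rule quadrilateral_sectors[where X = "\<lambda>a. qform (lift (x a))", OF ray k k_commute Z13 Z24 c orient];
        (assumption | (rule that; assumption)))
  show ?thesis
  proof (rule AS_det_ge_1_if_cyclically_ordered)
    fix a b :: nat assume ab: "a \<in> {1..4}" "b \<in> {1..4}" "a \<noteq> b"
    have "x a \<in> H2" "x b \<in> H2" "x a \<noteq> x b"
      using x ab by (auto simp: configs_def inj_on_def)
    then show "p_pair x a b = linear_form (of_real_pair (spinor x a b))" by (rule ray_spinor)
  next
    fix a b c d :: nat
    assume "a \<in> {1..4}" "b \<in> {1..4}" "a \<noteq> b" "c \<in> {1..4}" "d \<in> {1..4}" "c \<noteq> d" "position a b < position c d"
    moreover have "position c d < 8" by (simp add: position_def)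
    ultimately show "bracket (e a b *\<^sub>R spinor x a b) (e c d *\<^sub>R spinor x c d) > 0"
      using bracket_sectors_pos[OF D sector sector] by blast
  qed (rule e)
qed

theorem theorem1p1:
  fixes x :: "nat \<Rightarrow> real ^ 3"
  assumes "x \<in> configs 4 H2"
    and "\<forall>a\<in>{1..4}. x a \<notin> hyp_convex hull (x ` ({1..4} - {a}))"
  shows "cmod (AS_det 4 x) \<ge> 1"
proof -
  have x: "x \<in> configs 4 H2" "convex_position x" using assms by (simp_all add: convex_position_def)
  obtain \<pi> c where \<pi>: "\<pi> permutes {1..4}" and c: "\<And>a :: nat. a \<in> {1..4} \<Longrightarrow> c a > (0 :: real)"
    and rel: "c 1 *\<^sub>R lift (x (\<pi> 1)) + c 3 *\<^sub>R lift (x (\<pi> 3)) = c 2 *\<^sub>R lift (x (\<pi> 2)) + c 4 *\<^sub>R lift (x (\<pi> 4))"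
    using crossing_relation[OF x] by metis
  define y where "y = x \<circ> \<pi>"
  have y: "y \<in> configs 4 H2" "convex_position y"
    unfolding y_def by (rule convex_position_permute[OF x \<pi>])+
  have rel_y: "c 1 *\<^sub>R lift (y 1) + c 3 *\<^sub>R lift (y 3) = c 2 *\<^sub>R lift (y 2) + c 4 *\<^sub>R lift (y 4)"
    using rel by (simp add: y_def)
  consider (pos) "bracket (spinor y 3 1) (spinor y 4 2) * bracket (spinor y 4 2) (spinor y 1 3) * bracket (spinor y 3 1) (spinor y 1 3) > 0"
    | (neg) "bracket (spinor y 3 1) (spinor y 2 4) * bracket (spinor y 2 4) (spinor y 1 3) * bracket (spinor y 3 1) (spinor y 1 3) > 0"
    using crossing_orientation[OF y c rel_y] by blast
  then have "cmod (AS_det 4 y) \<ge> 1"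
  proof cases
    case pos
    with c show ?thesis by (rule AS_det_ge_1_oriented[OF y(1) _ rel_y])
  next
    case neg
    moreover define \<tau> where "\<tau> = Transposition.transpose 2 (4 :: nat)"
    have \<tau>: "\<tau> permutes {1..4}" unfolding \<tau>_def by (rule permutes_swap_id) auto
    have \<tau>s: "\<tau> 1 = 1" "\<tau> 2 = 4" "\<tau> 3 = 3" "\<tau> 4 = 2" by (simp_all add: \<tau>_def Transposition.transpose_def)
    ultimately have o: "bracket (spinor (y \<circ> \<tau>) 3 1) (spinor (y \<circ> \<tau>) 4 2) * bracket (spinor (y \<circ> \<tau>) 4 2) (spinor (y \<circ> \<tau>) 1 3)
        * bracket (spinor (y \<circ> \<tau>) 3 1) (spinor (y \<circ> \<tau>) 1 3) > 0"
      unfolding spinor_permute \<tau>s by simp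
    have "cmod (AS_det 4 (y \<circ> \<tau>)) \<ge> 1"
    proof (rule AS_det_ge_1_oriented[where c = "c \<circ> \<tau>", OF convex_position_permute(1)[OF y \<tau>] _ _ o])
      show "(c \<circ> \<tau>) a > 0" if "a \<in> {1..4}" for a using c permutes_in_image[OF \<tau>] that by (simp del: atLeastAtMost_iff)
      show "(c \<circ> \<tau>) 1 *\<^sub>R lift ((y \<circ> \<tau>) 1) + (c \<circ> \<tau>) 3 *\<^sub>R lift ((y \<circ> \<tau>) 3) =
          (c \<circ> \<tau>) 2 *\<^sub>R lift ((y \<circ> \<tau>) 2) + (c \<circ> \<tau>) 4 *\<^sub>R lift ((y \<circ> \<tau>) 4)"
        unfolding comp_apply \<tau>s rel_y by (rule add.commute)
    qed
    then show ?thesis by (simp add: cmod_AS_det_permute[OF \<tau>])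
  qed
  then show ?thesis by (simp add: y_def cmod_AS_det_permute[OF \<pi>])
qed

end
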